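(* Let $n\geq 2$ be an integer and let $\mathcal{H}(n)$ be the group with generators $x_1,\dots,x_n,y_1,\dots,y_n$ and defining relations, for all $x,x'\in X_0=\{x_1,\dots,x_n\}$, $y,y'\in Y_0=\{y_1,\dots,y_n\}$ and $z,z',z'',z'''\in X_0\cup Y_0$: \[ z^2=1,\ [x,x']=[y,y']=1,\ [x,y]^2=1,\ [[y,x],y']=1,\ [[x,y],z]^2=1,\ [[[z,z'],z''],z''']=1. \] Let $X=\langle X_0\rangle$ and $Y=\langle Y_0\rangle$. Then $\mathcal{H}(n)$ is an $n$-dimensional mixed dihedral group of order $2^{n(n^2+n+4)/2}$ relative to $X$ and $Y$, and the graph $\Sigma(\mathcal{H}(n),X,Y)$ is semisymmetric and locally $2$-arc-transitive, of valency $2^n$ and order $2^{n^2(n+1)/2+n+1}$.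
   Context: Commutators: $[a,b]=a^{-1}b^{-1}ab$. A finite group $H$ with subgroups $X,Y$ is an $n$-dimensional mixed dihedral group relative to $X$ and $Y$ if $X\cong Y\cong C_2^n$, $H=\langle X,Y\rangle$, and $H/H'\cong C_2^{2n}$ ($H'$ the derived subgroup). For such $H,X,Y$, the graph $\Sigma(H,X,Y)$ has vertex set $\{Xh,Yh: h\in H\}$ (right cosets) and edge set $\{\{Xh,Yg\}: h,g\in H,\ Xh\cap Yg\neq\emptyset\}$. A graph is semisymmetric if it is regular (all vertices have the same valency), its full automorphism group is transitive on edges, but not transitive on vertices. A $2$-arc is a vertex triple $(u,v,w)$ with $\{u,v\},\{v,w\}$ edges and $u\neq w$; a graph is locally $2$-arc-transitive if for every vertex $u$ the stabiliser of $u$ in the full automorphism group is transitive on the $2$-arcs starting at $u$. The order of a graph is its number of vertices. *)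

theory Defs
  imports "HOL-Algebra.Generated_Groups" "HOL-Algebra.Product_Groups"
    "HOL-Algebra.Elementary_Groups" "HOL-Algebra.Bij"
begin

section \<open>Groups given by generators and relators\<close>

text \<open>A letter \<open>(g, True)\<close> stands for the generator \<open>g\<close> and \<open>(g, False)\<close> for its formal inverse.\<close>

type_synonym 'g word = "('g \<times> bool) list"

definition words :: "'g set \<Rightarrow> 'g word set" where
  "words S = lists (S \<times> UNIV)"

definition word_inv :: "'g word \<Rightarrow> 'g word" where
  "word_inv w = rev (map (\<lambda>(g, b). (g, \<not> b)) w)"

definition word_comm :: "'g word \<Rightarrow> 'g word \<Rightarrow> 'g word" where
  "word_comm u v = word_inv u @ word_inv v @ u @ v"

text \<open>The congruence on words over \<open>S\<close> generated by free cancellation and by \<open>r = 1\<close> for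
  \<open>r \<in> R\<close>. The set \<open>R\<close> is meant to consist of words over \<open>S\<close>.\<close>

inductive_set pres_rel :: "'g set \<Rightarrow> 'g word set \<Rightarrow> ('g word \<times> 'g word) set"
  for S :: "'g set" and R :: "'g word set" where
  refl: "w \<in> words S \<Longrightarrow> (w, w) \<in> pres_rel S R"
| sym: "(u, v) \<in> pres_rel S R \<Longrightarrow> (v, u) \<in> pres_rel S R"
| trans: "(u, v) \<in> pres_rel S R \<Longrightarrow> (v, w) \<in> pres_rel S R \<Longrightarrow> (u, w) \<in> pres_rel S R"
| cancel: "u \<in> words S \<Longrightarrow> v \<in> words S \<Longrightarrow> g \<in> S \<Longrightarrow>
    (u @ [(g, b), (g, \<not> b)] @ v, u @ v) \<in> pres_rel S R"
| relator: "u \<in> words S \<Longrightarrow> v \<in> words S \<Longrightarrow> r \<in> R \<Longrightarrow> (u @ r @ v, u @ v) \<in> pres_rel S R"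

definition presented_group :: "'g set \<Rightarrow> 'g word set \<Rightarrow> 'g word set monoid" where
  "presented_group S R =
     \<lparr>carrier = words S // pres_rel S R,
      monoid.mult = (\<lambda>A B. \<Union>u\<in>A. \<Union>v\<in>B. pres_rel S R `` {u @ v}),
      one = pres_rel S R `` {[]}\<rparr>"


section \<open>Graphs\<close>

record 'v ugraph =
  verts :: "'v set"
  edges :: "'v set set"

definition simple_graph :: "'v ugraph \<Rightarrow> bool" where
  "simple_graph \<Gamma> \<longleftrightarrow>
     (\<forall>e \<in> edges \<Gamma>. \<exists>u \<in> verts \<Gamma>. \<exists>v \<in> verts \<Gamma>. u \<noteq> v \<and> e = {u, v})"

definition valency :: "'v ugraph \<Rightarrow> 'v \<Rightarrow> nat" where
  "valency \<Gamma> u = card {v \<in> verts \<Gamma>. {u, v} \<in> edges \<Gamma>}"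

definition has_valency :: "'v ugraph \<Rightarrow> nat \<Rightarrow> bool" where
  "has_valency \<Gamma> k \<longleftrightarrow> (\<forall>u \<in> verts \<Gamma>. valency \<Gamma> u = k)"

definition graph_auts :: "'v ugraph \<Rightarrow> ('v \<Rightarrow> 'v) set" where
  "graph_auts \<Gamma> = {f \<in> Bij (verts \<Gamma>).
     \<forall>u \<in> verts \<Gamma>. \<forall>v \<in> verts \<Gamma>. {u, v} \<in> edges \<Gamma> \<longleftrightarrow> {f u, f v} \<in> edges \<Gamma>}"

definition vertex_transitive :: "'v ugraph \<Rightarrow> bool" where
  "vertex_transitive \<Gamma> \<longleftrightarrow>
     (\<forall>u \<in> verts \<Gamma>. \<forall>v \<in> verts \<Gamma>. \<exists>f \<in> graph_auts \<Gamma>. f u = v)"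

definition edge_transitive :: "'v ugraph \<Rightarrow> bool" where
  "edge_transitive \<Gamma> \<longleftrightarrow>
     (\<forall>e \<in> edges \<Gamma>. \<forall>e' \<in> edges \<Gamma>. \<exists>f \<in> graph_auts \<Gamma>. f ` e = e')"

definition semisymmetric :: "'v ugraph \<Rightarrow> bool" where
  "semisymmetric \<Gamma> \<longleftrightarrow> simple_graph \<Gamma> \<and> (\<exists>k. has_valency \<Gamma> k) \<and>
     edge_transitive \<Gamma> \<and> \<not> vertex_transitive \<Gamma>"

definition two_arcs :: "'v ugraph \<Rightarrow> ('v \<times> 'v \<times> 'v) set" where
  "two_arcs \<Gamma> = {(u, v, w). u \<in> verts \<Gamma> \<and> v \<in> verts \<Gamma> \<and> w \<in> verts \<Gamma> \<and>
     {u, v} \<in> edges \<Gamma> \<and> {v, w} \<in> edges \<Gamma> \<and> u \<noteq> w}"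

definition locally_2_arc_transitive :: "'v ugraph \<Rightarrow> bool" where
  "locally_2_arc_transitive \<Gamma> \<longleftrightarrow>
     (\<forall>u \<in> verts \<Gamma>. \<forall>v w v' w'. (u, v, w) \<in> two_arcs \<Gamma> \<longrightarrow> (u, v', w') \<in> two_arcs \<Gamma> \<longrightarrow>
       (\<exists>f \<in> graph_auts \<Gamma>. f u = u \<and> f v = v' \<and> f w = w'))"


section \<open>Mixed dihedral groups and their coset graphs\<close>

text \<open>The group $C_2^n$ as a direct power.\<close>

definition C2_power :: "nat \<Rightarrow> (nat \<Rightarrow> int) monoid" where
  "C2_power n = product_group {..<n} (\<lambda>_. integer_mod_group 2)"

text \<open>The library's \<^const>\<open>derived\<close> uses the commutators $a b a^{-1} b^{-1}$ instead of
  $a^{-1} b^{-1} a b$; the subgroup generated by all of them is the same.\<close>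

definition mixed_dihedral :: "nat \<Rightarrow> 'a monoid \<Rightarrow> 'a set \<Rightarrow> 'a set \<Rightarrow> bool" where
  "mixed_dihedral n H X Y \<longleftrightarrow>
     group H \<and> finite (carrier H) \<and> subgroup X H \<and> subgroup Y H \<and>
     H\<lparr>carrier := X\<rparr> \<cong> C2_power n \<and> H\<lparr>carrier := Y\<rparr> \<cong> C2_power n \<and>
     carrier H = generate H (X \<union> Y) \<and>
     H Mod (derived H (carrier H)) \<cong> C2_power (2 * n)"

definition coset_graph :: "'a monoid \<Rightarrow> 'a set \<Rightarrow> 'a set \<Rightarrow> 'a set ugraph" where
  "coset_graph H X Y =
     \<lparr>verts = {X #>\<^bsub>H\<^esub> h | h. h \<in> carrier H} \<union> {Y #>\<^bsub>H\<^esub> h | h. h \<in> carrier H},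
      edges = {{X #>\<^bsub>H\<^esub> h, Y #>\<^bsub>H\<^esub> g} | h g. h \<in> carrier H \<and> g \<in> carrier H \<and>
                 (X #>\<^bsub>H\<^esub> h) \<inter> (Y #>\<^bsub>H\<^esub> g) \<noteq> {}}\<rparr>"


section \<open>The group $\mathcal{H}(n)$\<close>

datatype gen = Xgen nat | Ygen nat

definition gens :: "nat \<Rightarrow> gen set" where
  "gens n = Xgen ` {1..n} \<union> Ygen ` {1..n}"

definition X0_words :: "nat \<Rightarrow> gen word set" where
  "X0_words n = {[(Xgen i, True)] | i. i \<in> {1..n}}"

definition Y0_words :: "nat \<Rightarrow> gen word set" where
  "Y0_words n = {[(Ygen i, True)] | i. i \<in> {1..n}}"

definition Hn_relators :: "nat \<Rightarrow> gen word set" where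
  "Hn_relators n = (let X0 = X0_words n; Y0 = Y0_words n; Z0 = X0 \<union> Y0 in
     {z @ z | z. z \<in> Z0} \<union>
     {word_comm x x' | x x'. x \<in> X0 \<and> x' \<in> X0} \<union>
     {word_comm y y' | y y'. y \<in> Y0 \<and> y' \<in> Y0} \<union>
     {word_comm x y @ word_comm x y | x y. x \<in> X0 \<and> y \<in> Y0} \<union>
     {word_comm (word_comm y x) y' | x y y'. x \<in> X0 \<and> y \<in> Y0 \<and> y' \<in> Y0} \<union>
     {word_comm (word_comm x y) z @ word_comm (word_comm x y) z | x y z.
        x \<in> X0 \<and> y \<in> Y0 \<and> z \<in> Z0} \<union>
     {word_comm (word_comm (word_comm z z') z'') z''' | z z' z'' z'''.
        z \<in> Z0 \<and> z' \<in> Z0 \<and> z'' \<in> Z0 \<and> z''' \<in> Z0})"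

definition Hn :: "nat \<Rightarrow> gen word set monoid" where
  "Hn n = presented_group (gens n) (Hn_relators n)"

definition word_class :: "nat \<Rightarrow> gen word \<Rightarrow> gen word set" where
  "word_class n w = pres_rel (gens n) (Hn_relators n) `` {w}"

definition Xn :: "nat \<Rightarrow> gen word set set" where
  "Xn n = generate (Hn n) (word_class n ` X0_words n)"

definition Yn :: "nat \<Rightarrow> gen word set set" where
  "Yn n = generate (Hn n) (word_class n ` Y0_words n)"

end

theory Submission
  imports Defs "HOL-Algebra.FiniteProduct"
begin

text \<open>
  In \<open>H = \<H>(n)\<close> the normal closure \<open>N\<close> of \<open>Y\<close> is an elementary abelian 2-group, spanned by the
  \<open>y\<^sub>j\<close>, the \<open>[x\<^sub>i, y\<^sub>j]\<close> and the \<open>[[x\<^sub>i, y\<^sub>j], x\<^sub>k]\<close> with \<open>i < k\<close>, and \<open>H = X N\<close>; this bounds the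
  order from above. As a module under \<open>X \<cong> F\<^sub>2\<^sup>n\<close>, \<open>N\<close> is the tensor product of \<open>F\<^sub>2[X] / I\<^sup>3\<close> and \<open>Y\<close>,
  where \<open>I\<close> is the augmentation ideal. The dual of \<open>F\<^sub>2[X] / I\<^sup>3\<close> is the space of quadratic polynomial
  functions on \<open>X\<close>, so letting \<open>X\<close> act by translation on functions of quadratic polynomials gives a
  homomorphism \<open>\<phi>\<close> from \<open>H\<close> to a concrete group; evaluation at the monomials of degree at most two
  shows that \<open>\<phi>\<close> is injective. All elements of \<open>X\<close> and \<open>Y\<close>, not only the generators, satisfy the
  defining relations in the image of \<open>\<phi>\<close>, hence in \<open>H\<close>, so transvections of \<open>X\<close> and of \<open>Y\<close> extend to
  automorphisms of \<open>H\<close>; with right multiplications they give the 2-arcs.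

  To see that the graph is not vertex-transitive, consider the walks of length four without
  backtracking between two vertices. From the vertex \<open>Y\<close> to \<open>Y x y x\<close> there is one through \<open>X y\<^sub>0\<close> for
  every \<open>y\<^sub>0 \<in> Y\<close>, because \<open>[x, y]\<close> commutes with \<open>Y\<close>. A walk from \<open>X\<close> to \<open>X h\<close> that starts with
  \<open>Y x\<^sub>0\<close> writes the \<open>N\<close>-part of \<open>h\<close> as \<open>a \<otimes> w + x\<^sub>0 \<otimes> w'\<close>. Quadratic polynomials separate a point
  from three others, so \<open>h\<close> allows at most two values of \<open>x\<^sub>0\<close>.
\<close>

subsection \<open>Evaluating words and von Dyck's theorem\<close>

fun word_eval :: "('a, 'b) monoid_scheme \<Rightarrow> ('g \<Rightarrow> 'a) \<Rightarrow> 'g word \<Rightarrow> 'a" where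
  "word_eval G f [] = \<one>\<^bsub>G\<^esub>"
| "word_eval G f ((g, b) # w) = (if b then f g else inv\<^bsub>G\<^esub> f g) \<otimes>\<^bsub>G\<^esub> word_eval G f w"

definition group_comm :: "('a, 'b) monoid_scheme \<Rightarrow> 'a \<Rightarrow> 'a \<Rightarrow> 'a" where
  "group_comm G a b = inv\<^bsub>G\<^esub> a \<otimes>\<^bsub>G\<^esub> inv\<^bsub>G\<^esub> b \<otimes>\<^bsub>G\<^esub> a \<otimes>\<^bsub>G\<^esub> b"

lemma words_append [simp]: "u @ v \<in> words S \<longleftrightarrow> u \<in> words S \<and> v \<in> words S"
  by (simp add: words_def)

lemma words_Nil [simp]: "[] \<in> words S"
  by (simp add: words_def)

lemma words_Cons [simp]: "(g, b) # w \<in> words S \<longleftrightarrow> g \<in> S \<and> w \<in> words S"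
  by (auto simp: words_def)

lemma word_inv_Cons [simp]: "word_inv ((g, b) # w) = word_inv w @ [(g, \<not> b)]"
  by (simp add: word_inv_def)

lemma word_inv_Nil [simp]: "word_inv [] = []"
  by (simp add: word_inv_def)

lemma words_inv [simp]: "word_inv w \<in> words S \<longleftrightarrow> w \<in> words S"
  by (induction w) (auto simp: words_def word_inv_def)

lemma words_comm [simp]: "word_comm u v \<in> words S \<longleftrightarrow> u \<in> words S \<and> v \<in> words S"
  by (auto simp: word_comm_def)

context group
begin

lemma group_comm_closed [simp]:
  "a \<in> carrier G \<Longrightarrow> b \<in> carrier G \<Longrightarrow> group_comm G a b \<in> carrier G"
  by (simp add: group_comm_def)

lemma word_eval_closed:
  "w \<in> words S \<Longrightarrow> f ` S \<subseteq> carrier G \<Longrightarrow> word_eval G f w \<in> carrier G"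
proof (induction w)
  case (Cons p w)
  then show ?case by (cases p) auto
qed simp

lemma word_eval_append:
  assumes "f ` S \<subseteq> carrier G" "u \<in> words S" "v \<in> words S"
  shows "word_eval G f (u @ v) = word_eval G f u \<otimes> word_eval G f v"
  using assms(2)
proof (induction u)
  case Nil
  then show ?case using word_eval_closed[OF assms(3,1)] by simp
next
  case (Cons p u)
  obtain g b where p: "p = (g, b)" by force
  then have "f g \<in> carrier G" "u \<in> words S" using Cons.prems assms(1) by auto
  then show ?case
    using Cons assms word_eval_closed[OF _ assms(1)] p by (simp add: m_assoc)
qed

lemma word_eval_inv:
  assumes "f ` S \<subseteq> carrier G" "w \<in> words S"
  shows "word_eval G f (word_inv w) = inv (word_eval G f w)"
  using assms(2)
proof (induction w)
  case (Cons p w)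
  obtain g b where p: "p = (g, b)" by force
  then have g: "g \<in> S" "f g \<in> carrier G" "w \<in> words S" using Cons.prems assms(1) by auto
  have "word_eval G f (word_inv (p # w)) = inv (word_eval G f w) \<otimes> word_eval G f [(g, \<not> b)]"
    using g p Cons.IH assms by (simp add: word_eval_append[where S = S])
  then show ?case
    using g p word_eval_closed[OF g(3) assms(1)] by (simp add: inv_mult_group)
qed simp

lemma word_eval_comm:
  assumes "f ` S \<subseteq> carrier G" "u \<in> words S" "v \<in> words S"
  shows "word_eval G f (word_comm u v) = group_comm G (word_eval G f u) (word_eval G f v)"
  using assms word_eval_closed[OF _ assms(1)]
  by (simp add: word_comm_def group_comm_def word_eval_append[where S = S] word_eval_inv[where S = S] m_assoc)

text \<open>Each generating step of the congruence preserves the value: cancellation by the group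
  laws, a relator by \<open>rel\<close>. Evaluation is thus well defined on the presented
  group.\<close>

lemma word_eval_pres_rel:
  assumes "(u, v) \<in> pres_rel S R" and f: "f ` S \<subseteq> carrier G" and "R \<subseteq> words S"
    and rel: "\<And>r. r \<in> R \<Longrightarrow> word_eval G f r = \<one>"
  shows "word_eval G f u = word_eval G f v"
  using assms(1)
proof induction
  case (cancel u v g b)
  then have "f g \<in> carrier G" using f by auto
  with cancel show ?case
    using word_eval_closed[OF _ f] by (simp add: word_eval_append[OF f] m_assoc flip: m_assoc[of "inv f g"] m_assoc[of "f g"])
next
  case (relator u v r)
  moreover have "r \<in> words S" using relator assms by auto
  ultimately show ?case
    using word_eval_closed[OF _ f] rel by (simp add: word_eval_append[OF f])
qed auto

end

section \<open>The group defined by generators and relators\<close>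

locale presentation =
  fixes S :: "'g set" and R :: "'g word set"
  assumes relators: "R \<subseteq> words S"
begin

abbreviation "P \<equiv> presented_group S R"

definition cls :: "'g word \<Rightarrow> 'g word set" where
  "cls w = pres_rel S R `` {w}"

lemma pres_rel_words: "(u, v) \<in> pres_rel S R \<Longrightarrow> u \<in> words S \<and> v \<in> words S"
  by (induction rule: pres_rel.induct) (use relators in auto)

lemma equiv_pres_rel: "equiv (words S) (pres_rel S R)"
  by (rule equivI) (auto simp: refl_on_def sym_def trans_def dest: pres_rel_words
      intro: pres_rel.intros)

lemma pres_rel_context:
  assumes "(u, v) \<in> pres_rel S R" "a \<in> words S" "b \<in> words S"
  shows "(a @ u @ b, a @ v @ b) \<in> pres_rel S R"
  using assms(1)
proof induction
  case (cancel u v g b')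
  then show ?case using pres_rel.cancel[of "a @ u" S "v @ b" g b' R] assms by simp
next
  case (relator u v r)
  then show ?case using pres_rel.relator[of "a @ u" S "v @ b" r R] assms by simp
qed (use assms in \<open>auto intro: pres_rel.intros\<close>)

lemma pres_rel_append:
  assumes "(u, v) \<in> pres_rel S R" "(u', v') \<in> pres_rel S R"
  shows "(u @ u', v @ v') \<in> pres_rel S R"
  using pres_rel_context[OF assms(1), of "[]" u'] pres_rel_context[OF assms(2), of v "[]"]
    pres_rel_words[OF assms(1)] pres_rel_words[OF assms(2)]
  by (auto intro: pres_rel.trans)

lemma cls_eq_iff: "u \<in> words S \<Longrightarrow> v \<in> words S \<Longrightarrow> cls u = cls v \<longleftrightarrow> (u, v) \<in> pres_rel S R"
  unfolding cls_def by (simp add: eq_equiv_class_iff[OF equiv_pres_rel])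

lemma carrier_P: "carrier P = cls ` words S"
  by (auto simp: presented_group_def quotient_def cls_def)

lemma cls_closed [simp]: "w \<in> words S \<Longrightarrow> cls w \<in> carrier P"
  by (simp add: carrier_P)

lemma one_P: "\<one>\<^bsub>P\<^esub> = cls []"
  by (simp add: presented_group_def cls_def)

lemma mult_P:
  assumes "u \<in> words S" "v \<in> words S"
  shows "cls u \<otimes>\<^bsub>P\<^esub> cls v = cls (u @ v)"
proof -
  have "congruent2 (pres_rel S R) (pres_rel S R) (\<lambda>u v. cls (u @ v))"
    by (rule congruent2I[OF equiv_pres_rel equiv_pres_rel])
      (metis cls_eq_iff pres_rel.refl pres_rel_append pres_rel_words words_append)+
  from UN_equiv_class2[OF equiv_pres_rel equiv_pres_rel this assms]
  show ?thesis by (simp add: presented_group_def cls_def)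
qed

lemma cls_inv_append: "w \<in> words S \<Longrightarrow> (word_inv w @ w, []) \<in> pres_rel S R"
proof (induction w)
  case (Cons p w)
  obtain g b where p: "p = (g, b)" by force
  then have "(word_inv w @ [(g, \<not> b), (g, \<not> \<not> b)] @ w, word_inv w @ w) \<in> pres_rel S R"
    using Cons.prems by (intro pres_rel.cancel) auto
  then show ?case using p Cons by (auto intro: pres_rel.trans)
qed (simp add: pres_rel.refl)

lemma group_P: "group P"
proof (rule groupI)
  show "\<exists>y\<in>carrier P. y \<otimes>\<^bsub>P\<^esub> x = \<one>\<^bsub>P\<^esub>" if "x \<in> carrier P" for x
  proof -
    obtain w where w: "w \<in> words S" "x = cls w" using \<open>x \<in> carrier P\<close> carrier_P by auto
    then have "cls (word_inv w) \<otimes>\<^bsub>P\<^esub> x = \<one>\<^bsub>P\<^esub>"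
      using cls_inv_append by (simp add: one_P mult_P cls_eq_iff)
    then show ?thesis using w by (metis cls_closed words_inv)
  qed
qed (auto simp: carrier_P one_P mult_P)

sublocale P: group P
  by (rule group_P)

lemma word_eval_gen:
  "w \<in> words S \<Longrightarrow> word_eval P (\<lambda>g. cls [(g, True)]) w = cls w"
proof (induction w)
  case (Cons p w)
  obtain g b where p: "p = (g, b)" by force
  then have g: "g \<in> S" "w \<in> words S" using Cons.prems by auto
  have "inv\<^bsub>P\<^esub> (cls [(g, True)]) = cls [(g, False)]"
    using g cls_inv_append[of "[(g, True)]"] by (intro P.inv_equality) (auto simp: mult_P one_P cls_eq_iff)
  then show ?case using p g Cons.IH by (simp add: mult_P)
qed (simp add: one_P)

lemma word_eval_relator: "r \<in> R \<Longrightarrow> word_eval P (\<lambda>g. cls [(g, True)]) r = \<one>\<^bsub>P\<^esub>"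
  using relators pres_rel.relator[of "[]" S "[]" r R]
  by (subst word_eval_gen) (auto simp: one_P cls_eq_iff subset_iff)

text \<open>Evaluating a word at the classes of its letters returns its own class, so induction on
  words becomes induction on group elements. It serves to show that the classes of the letters
  generate the group.\<close>

lemma generated_induct [consumes 1, case_names one gen inv]:
  assumes "x \<in> carrier P" "Q \<one>\<^bsub>P\<^esub>"
    and "\<And>g y. g \<in> S \<Longrightarrow> y \<in> carrier P \<Longrightarrow> Q y \<Longrightarrow> Q (cls [(g, True)] \<otimes>\<^bsub>P\<^esub> y)"
    and "\<And>g y. g \<in> S \<Longrightarrow> y \<in> carrier P \<Longrightarrow> Q y \<Longrightarrow> Q (inv\<^bsub>P\<^esub> cls [(g, True)] \<otimes>\<^bsub>P\<^esub> y)"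
  shows "Q x"
proof -
  obtain w where w: "w \<in> words S" "x = cls w" using assms(1) carrier_P by auto
  have "Q (word_eval P (\<lambda>g. cls [(g, True)]) w)" using w(1)
  proof (induction w)
    case (Cons p w)
    obtain g b where "p = (g, b)" by force
    with Cons show ?case using assms(3,4) by (auto simp: word_eval_gen)
  qed (use assms in simp)
  then show ?thesis using w by (simp add: word_eval_gen)
qed

text \<open>Evaluation is constant on congruence classes, so it may be computed on any
  representative; \<open>h\<close> uses the one chosen by \<open>SOME\<close>.\<close>

lemma von_Dyck:
  assumes "group G" and f: "f ` S \<subseteq> carrier G"
    and "\<And>r. r \<in> R \<Longrightarrow> word_eval G f r = \<one>\<^bsub>G\<^esub>"
  obtains h where "h \<in> hom P G" "\<And>g. g \<in> S \<Longrightarrow> h (cls [(g, True)]) = f g"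
proof -
  interpret G: group G by fact
  define h where "h A = word_eval G f (SOME w. w \<in> A)" for A
  have h: "h (cls w) = word_eval G f w" if "w \<in> words S" for w
  proof -
    have "w \<in> cls w" using that by (simp add: cls_def pres_rel.refl)
    then have "(w, SOME w'. w' \<in> cls w) \<in> pres_rel S R"
      unfolding cls_def by (metis Image_singleton_iff someI)
    from G.word_eval_pres_rel[OF this f relators assms(3)]
    show ?thesis by (simp add: h_def)
  qed
  have "h \<in> hom P G"
    by (rule homI)
      (auto simp: carrier_P h mult_P G.word_eval_append[OF f] G.word_eval_closed[OF _ f])
  moreover have "h (cls [(g, True)]) = f g" if "g \<in> S" for g
    using that f by (subst h) auto
  ultimately show ?thesis using that by blast
qed

end

subsection \<open>Elementary abelian 2-groups with a dual basis of characters\<close>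

lemma (in group) inv_commute:
  assumes "x \<in> carrier G" "s \<in> carrier G" "x \<otimes> s = s \<otimes> x"
  shows "inv x \<otimes> s = s \<otimes> inv x"
proof -
  have "inv x \<otimes> s = inv x \<otimes> (s \<otimes> x) \<otimes> inv x"
    using assms(1,2) by (simp add: m_assoc)
  also have "\<dots> = inv x \<otimes> x \<otimes> s \<otimes> inv x"
    using assms by (metis inv_closed m_assoc)
  finally show ?thesis using assms(1,2) by simp
qed

lemma (in group) mult_commute:
  assumes "x \<in> carrier G" "y \<in> carrier G" "s \<in> carrier G"
    and "x \<otimes> s = s \<otimes> x" "y \<otimes> s = s \<otimes> y"
  shows "x \<otimes> y \<otimes> s = s \<otimes> (x \<otimes> y)"
  using assms by (metis m_assoc)

lemma (in group) subgroup_centralizer: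
  assumes "S \<subseteq> carrier G"
  shows "subgroup {x \<in> carrier G. \<forall>s\<in>S. x \<otimes> s = s \<otimes> x} G"
proof (rule subgroupI)
  fix a b assume a: "a \<in> {x \<in> carrier G. \<forall>s\<in>S. x \<otimes> s = s \<otimes> x}"
  show "inv a \<in> {x \<in> carrier G. \<forall>s\<in>S. x \<otimes> s = s \<otimes> x}"
    using a assms by (auto intro!: inv_commute)
  assume b: "b \<in> {x \<in> carrier G. \<forall>s\<in>S. x \<otimes> s = s \<otimes> x}"
  show "a \<otimes> b \<in> {x \<in> carrier G. \<forall>s\<in>S. x \<otimes> s = s \<otimes> x}"
    using a b assms by (auto intro!: mult_commute)
qed (use assms in \<open>auto simp: subset_iff intro!: exI[of _ \<one>]\<close>)

text \<open>The centralizer of \<open>S\<close> contains \<open>S\<close> and hence the generated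
  subgroup. So \<open>S\<close> lies in the centralizer of that subgroup, which therefore contains
  the subgroup itself.\<close>

lemma (in group) comm_group_generate:
  assumes S: "S \<subseteq> carrier G" and comm: "\<And>s t. s \<in> S \<Longrightarrow> t \<in> S \<Longrightarrow> s \<otimes> t = t \<otimes> s"
  shows "comm_group (G\<lparr>carrier := generate G S\<rparr>)"
proof -
  let ?Z = "\<lambda>T. {x \<in> carrier G. \<forall>s\<in>T. x \<otimes> s = s \<otimes> x}"
  have "generate G S \<subseteq> ?Z S"
    using S comm by (intro generate_subgroup_incl[OF _ subgroup_centralizer]) auto
  then have "S \<subseteq> ?Z (generate G S)" using S by auto
  then have *: "generate G S \<subseteq> ?Z (generate G S)"
    using generate_incl[OF S] by (intro generate_subgroup_incl[OF _ subgroup_centralizer]) auto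
  show ?thesis
    using subgroup_imp_group[OF generate_is_subgroup[OF S]] *
    by (intro group.group_comm_groupI) auto
qed

lemma carrier_C2_power: "carrier (C2_power m) = {..<m} \<rightarrow>\<^sub>E {0..<2}"
  by (simp add: C2_power_def carrier_integer_mod_group)

text \<open>A vector space over the field of two elements, written multiplicatively, with a spanning
  family \<open>g\<close> and dual linear functionals \<open>\<chi> i\<close>; their values are
  added by \<open>\<noteq>\<close>. The generators bound the size from above, the functionals give
  independence.\<close>

locale C2_basis = comm_group C for C (structure) +
  fixes I :: "'i set" and g :: "'i \<Rightarrow> 'a" and \<chi> :: "'i \<Rightarrow> 'a \<Rightarrow> bool"
  assumes finite_I: "finite I"
    and carrier_gen: "carrier C = generate C (g ` I)"
    and involution: "i \<in> I \<Longrightarrow> g i \<otimes> g i = \<one>"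
    and character: "i \<in> I \<Longrightarrow> a \<in> carrier C \<Longrightarrow> b \<in> carrier C \<Longrightarrow> \<chi> i (a \<otimes> b) = (\<chi> i a \<noteq> \<chi> i b)"
    and dual: "i \<in> I \<Longrightarrow> j \<in> I \<Longrightarrow> \<chi> i (g j) = (i = j)"
begin

lemma g_closed [simp]: "i \<in> I \<Longrightarrow> g i \<in> carrier C"
  using generate.incl[of "g i" "g ` I" C] carrier_gen by auto

text \<open>The product runs over all of \<open>I\<close> with factors one outside \<open>E\<close>,
  so products multiply factor by factor and \<open>E\<close> may be any set.\<close>

definition prod_of :: "'i set \<Rightarrow> 'a" where
  "prod_of E = (\<Otimes>i\<in>I. if i \<in> E then g i else \<one>)"

lemma prod_of_closed [simp]: "prod_of E \<in> carrier C"
  unfolding prod_of_def by (intro finprod_closed) auto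

lemma prod_of_mult: "prod_of E \<otimes> prod_of F = prod_of {i. i \<in> E \<longleftrightarrow> i \<notin> F}"
proof -
  have "prod_of E \<otimes> prod_of F
      = (\<Otimes>i\<in>I. (if i \<in> E then g i else \<one>) \<otimes> (if i \<in> F then g i else \<one>))"
    unfolding prod_of_def by (intro finprod_multf[symmetric]) auto
  also have "\<dots> = prod_of {i. i \<in> E \<longleftrightarrow> i \<notin> F}"
    unfolding prod_of_def by (intro finprod_cong') (auto simp: involution)
  finally show ?thesis .
qed

lemma character_one: "i \<in> I \<Longrightarrow> \<not> \<chi> i \<one>"
  using character[of i \<one> \<one>] by simp

lemma character_prod_of: "i \<in> I \<Longrightarrow> \<chi> i (prod_of E) \<longleftrightarrow> i \<in> E"
proof -
  assume i: "i \<in> I"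
  \<comment> \<open>The range of the product is generalized from \<open>I\<close> to a subset
    \<open>J\<close>, on which the induction runs; \<open>i\<close> stays fixed in
    \<open>I\<close>.\<close>
  have "\<chi> i (\<Otimes>j\<in>J. if j \<in> E then g j else \<one>) \<longleftrightarrow> i \<in> E \<and> i \<in> J" if "J \<subseteq> I" for J
    using finite_subset[OF that finite_I] that
  proof (induction J)
    case (insert j J)
    let ?f = "\<lambda>j. if j \<in> E then g j else \<one>"
    have cl: "?f j \<in> carrier C" "?f \<in> J \<rightarrow> carrier C" using insert.prems by auto
    have *: "finprod C ?f (insert j J) = ?f j \<otimes> finprod C ?f J"
      using insert.hyps cl by (intro finprod_insert)
    have "\<chi> i (finprod C ?f (insert j J)) = (\<chi> i (?f j) \<noteq> \<chi> i (finprod C ?f J))"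
      unfolding * by (rule character[OF i cl(1) finprod_closed[OF cl(2)]])
    then show ?case
      using insert i by (auto simp del: finprod_insert simp: dual character_one)
  qed (use i character_one in simp)
  then show ?thesis using i unfolding prod_of_def by blast
qed

lemma prod_of_cong: "E \<inter> I = F \<inter> I \<Longrightarrow> prod_of E = prod_of F"
  unfolding prod_of_def by (rule finprod_cong') auto

lemma prod_of_singleton: "i \<in> I \<Longrightarrow> prod_of {i} = g i"
  unfolding prod_of_def using finprod_singleton_swap[of i I g] finite_I by simp

lemma in_range_prod_of:
  assumes "h \<in> carrier C"
  shows "h \<in> range prod_of"
proof -
  have "h \<in> generate C (g ` I)" using assms carrier_gen by simp
  then show ?thesis
  proof induction
    case one
    have "\<one> = prod_of {}" by (simp add: prod_of_def)
    then show ?case by blast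
  next
    case (incl h)
    then obtain i where i: "i \<in> I" "h = g i" by auto
    then have "h = prod_of {i}" by (simp add: prod_of_singleton)
    then show ?case by simp
  next
    case (inv h)
    then obtain i where i: "i \<in> I" "h = g i" by auto
    then have "inv h = h" by (simp add: inv_equality involution)
    also have "\<dots> = prod_of {i}" using i by (simp add: prod_of_singleton)
    finally show ?case by simp
  next
    case (eng h1 h2)
    then obtain E F where "h1 = prod_of E" "h2 = prod_of F" by blast
    then show ?case by (simp add: prod_of_mult)
  qed
qed

definition support :: "'a \<Rightarrow> 'i set" where
  "support h = {i \<in> I. \<chi> i h}"

lemma support_prod_of: "support (prod_of E) = E \<inter> I"
  by (auto simp: support_def character_prod_of)

lemma prod_of_support:
  assumes "h \<in> carrier C"
  shows "prod_of (support h) = h"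
proof -
  obtain E where "h = prod_of E" using in_range_prod_of[OF assms] by blast
  moreover have "prod_of (E \<inter> I) = prod_of E" by (rule prod_of_cong) auto
  ultimately show ?thesis by (simp add: support_prod_of)
qed

lemma bij_support: "bij_betw support (carrier C) (Pow I)"
  by (rule bij_betwI[where g = prod_of])
    (auto simp: prod_of_support support_prod_of, auto simp: support_def)

lemma card_carrier: "card (carrier C) = 2 ^ card I"
  using bij_betw_same_card[OF bij_support] finite_I by (simp add: card_Pow)

lemma eq_one_if_characters_vanish:
  "h \<in> carrier C \<Longrightarrow> (\<And>i. i \<in> I \<Longrightarrow> \<not> \<chi> i h) \<Longrightarrow> h = \<one>"
  using prod_of_support[of h] prod_of_cong[of "support h" "{}"] by (auto simp: support_def prod_of_def)

lemma square_eq_one: "h \<in> carrier C \<Longrightarrow> h \<otimes> h = \<one>"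
  by (intro eq_one_if_characters_vanish) (auto simp: character)

text \<open>The characters, listed by an enumeration \<open>\<beta>\<close> of \<open>I\<close>, are
  the coordinates of the isomorphism.\<close>

lemma iso_C2_power: "C \<cong> C2_power (card I)"
proof -
  obtain \<beta> where \<beta>: "bij_betw \<beta> {..<card I} I"
    using ex_bij_betw_nat_finite[OF finite_I] by (auto simp: atLeast0LessThan)
  define \<theta> where "\<theta> h = (\<lambda>k\<in>{..<card I}. if \<chi> (\<beta> k) h then 1 else (0::int))" for h
  have \<beta>_in: "\<beta> k \<in> I" if "k < card I" for k
    using \<beta> that by (auto simp: bij_betw_def)
  have hom: "\<theta> \<in> hom C (C2_power (card I))"
    by (rule homI) (auto simp: \<theta>_def C2_power_def carrier_integer_mod_group character \<beta>_in fun_eq_iff)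
  have inj: "inj_on \<theta> (carrier C)"
  proof (rule inj_onI)
    fix a b assume ab: "a \<in> carrier C" "b \<in> carrier C" "\<theta> a = \<theta> b"
    have "\<chi> i a = \<chi> i b" if i: "i \<in> I" for i
    proof -
      obtain k where k: "k < card I" "i = \<beta> k" using bij_betw_imp_surj_on[OF \<beta>] i by blast
      from fun_cong[OF ab(3), of k] k show ?thesis by (simp add: \<theta>_def split: if_splits)
    qed
    then have "support a = support b" by (auto simp: support_def)
    then have "prod_of (support a) = prod_of (support b)" by simp
    then show "a = b" using ab(1,2) by (simp only: prod_of_support)
  qed
  have surj: "y \<in> \<theta> ` carrier C" if y: "y \<in> carrier (C2_power (card I))" for y
  proof
    \<comment> \<open>The preimage of \<open>y\<close> is the product of the generators at which
      \<open>y\<close> has coordinate one.\<close>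
    let ?E = "\<beta> ` {k \<in> {..<card I}. y k = 1}"
    have "\<theta> (prod_of ?E) k = y k" for k
    proof (cases "k < card I")
      case True
      have "\<beta> k \<in> ?E \<longleftrightarrow> y k = 1" using \<beta> True by (auto simp: bij_betw_def inj_on_def)
      moreover have "y k = 0 \<or> y k = 1"
        using PiE_mem[OF y[unfolded carrier_C2_power], of k] True by auto
      ultimately show ?thesis using True character_prod_of[OF \<beta>_in[OF True]] by (auto simp: \<theta>_def)
    next
      case False
      then show ?thesis using PiE_arb[OF y[unfolded carrier_C2_power], of k] by (simp add: \<theta>_def)
    qed
    then show "y = \<theta> (prod_of ?E)" by (intro ext) simp
  qed simp
  have "\<theta> \<in> iso C (C2_power (card I))"
    using hom inj surj hom_carrier[OF hom] by (auto simp: iso_def bij_betw_def)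
  then show ?thesis by (rule is_isoI)
qed

end

text \<open>Additivity of the characters is asked only on the generated subgroup, since the
  characters used later for \<open>N\<close> are in general not additive on the whole group.\<close>

lemma (in group) C2_basis_generate:
  assumes "finite I" and g: "g ` I \<subseteq> carrier G"
    and "\<And>i j. i \<in> I \<Longrightarrow> j \<in> I \<Longrightarrow> g i \<otimes> g j = g j \<otimes> g i"
    and "\<And>i. i \<in> I \<Longrightarrow> g i \<otimes> g i = \<one>"
    and "\<And>i a b. i \<in> I \<Longrightarrow> a \<in> generate G (g ` I) \<Longrightarrow> b \<in> generate G (g ` I) \<Longrightarrow>
      \<chi> i (a \<otimes> b) = (\<chi> i a \<noteq> \<chi> i b)"
    and "\<And>i j. i \<in> I \<Longrightarrow> j \<in> I \<Longrightarrow> \<chi> i (g j) = (i = j)"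
  shows "C2_basis (G\<lparr>carrier := generate G (g ` I)\<rparr>) I g \<chi>"
proof -
  interpret C: comm_group "G\<lparr>carrier := generate G (g ` I)\<rparr>"
    using assms(3) g by (intro comm_group_generate) auto
  show ?thesis
    using assms generate_consistent[of "g ` I" "generate G (g ` I)"] generate_is_subgroup[OF g]
    by unfold_locales (auto intro: generate.incl)
qed

subsection \<open>A concrete model\<close>

definition vadd :: "('i \<Rightarrow> bool) \<Rightarrow> ('i \<Rightarrow> bool) \<Rightarrow> 'i \<Rightarrow> bool" (infixl "\<oplus>\<^sub>v" 65) where
  "u \<oplus>\<^sub>v v = (\<lambda>i. u i \<noteq> v i)"

definition vzero :: "'i \<Rightarrow> bool" where
  "vzero = (\<lambda>_. False)"

lemma vadd_assoc: "u \<oplus>\<^sub>v v \<oplus>\<^sub>v w = u \<oplus>\<^sub>v (v \<oplus>\<^sub>v w)"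
  and vadd_commute: "u \<oplus>\<^sub>v v = v \<oplus>\<^sub>v u"
  and vadd_left_commute: "u \<oplus>\<^sub>v (v \<oplus>\<^sub>v w) = v \<oplus>\<^sub>v (u \<oplus>\<^sub>v w)"
  by (auto simp: vadd_def fun_eq_iff)

lemmas vadd_ac = vadd_assoc vadd_commute vadd_left_commute

lemma vadd_simps [simp]:
  "u \<oplus>\<^sub>v u = vzero" "u \<oplus>\<^sub>v vzero = u" "vzero \<oplus>\<^sub>v u = u" "u \<oplus>\<^sub>v (u \<oplus>\<^sub>v w) = w"
  by (auto simp: vadd_def vzero_def fun_eq_iff)

lemma vadd_apply: "(u \<oplus>\<^sub>v v) i = (u i \<noteq> v i)"
  and vzero_apply: "vzero i = False"
  by (simp_all add: vadd_def vzero_def)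

type_synonym vec = "nat \<Rightarrow> bool"

text \<open>Polynomial functions of degree at most two are those whose third differences vanish.\<close>

definition quadratic :: "(vec \<Rightarrow> bool) \<Rightarrow> bool" where
  "quadratic p \<longleftrightarrow> (\<forall>u a b c.
     p u = (p (u \<oplus>\<^sub>v a) \<noteq> (p (u \<oplus>\<^sub>v b) \<noteq> (p (u \<oplus>\<^sub>v c) \<noteq> (p (u \<oplus>\<^sub>v a \<oplus>\<^sub>v b) \<noteq>
       (p (u \<oplus>\<^sub>v a \<oplus>\<^sub>v c) \<noteq> (p (u \<oplus>\<^sub>v b \<oplus>\<^sub>v c) \<noteq> p (u \<oplus>\<^sub>v a \<oplus>\<^sub>v b \<oplus>\<^sub>v c))))))))"

lemma quadratic_shift:
  assumes "quadratic p"
  shows "quadratic (\<lambda>u. p (u \<oplus>\<^sub>v w))"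
proof -
  have "u \<oplus>\<^sub>v a \<oplus>\<^sub>v w = u \<oplus>\<^sub>v w \<oplus>\<^sub>v a" for u a
    by (simp add: vadd_ac)
  with assms show ?thesis unfolding quadratic_def by simp
qed

lemma quadratic_shift_iff [simp]: "quadratic (\<lambda>u. p (u \<oplus>\<^sub>v w)) \<longleftrightarrow> quadratic p"
  using quadratic_shift[of p w] quadratic_shift[of "\<lambda>u. p (u \<oplus>\<^sub>v w)" w]
  by (auto simp: vadd_assoc)

definition affine_fun :: "(vec \<Rightarrow> bool) \<Rightarrow> bool" where
  "affine_fun l \<longleftrightarrow> (\<forall>u v. l (u \<oplus>\<^sub>v v) = (l u \<noteq> (l v \<noteq> l vzero)))"

lemma affine_fun_coord: "affine_fun (\<lambda>u. u i)"
  and affine_fun_const: "affine_fun (\<lambda>u. b)"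
  and affine_fun_add: "affine_fun k \<Longrightarrow> affine_fun l \<Longrightarrow> affine_fun (\<lambda>u. k u \<noteq> l u)"
  unfolding affine_fun_def by (auto simp: vadd_def vzero_def)

text \<open>Once both factors are expanded by the affine law, the vanishing of the third difference
  is a Boolean identity in their values at \<open>u\<close>, \<open>a\<close>, \<open>b\<close>,
  \<open>c\<close> and \<open>vzero\<close>.\<close>

lemma quadratic_mult_affine:
  assumes "affine_fun k" "affine_fun l"
  shows "quadratic (\<lambda>u. k u \<and> l u)"
proof -
  have kl: "k (u \<oplus>\<^sub>v v) = (k u \<noteq> (k v \<noteq> k vzero))" "l (u \<oplus>\<^sub>v v) = (l u \<noteq> (l v \<noteq> l vzero))" for u v
    using assms unfolding affine_fun_def by auto
  show ?thesis
    unfolding quadratic_def kl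
    apply (intro allI)
    subgoal for u a b c
      by (cases "k u"; cases "k a"; cases "k b"; cases "k c"; cases "k vzero"; simp; blast)
    done
qed

text \<open>The polynomial is a product of two affine functions that are true at \<open>b\<close>:
  the first is false at \<open>c1\<close> and \<open>c2\<close>, the second at
  \<open>c3\<close>.\<close>

lemma quadratic_separation:
  assumes "b \<noteq> c1" "b \<noteq> c2" "b \<noteq> c3"
  obtains p where "quadratic p" "p b" "\<not> p c1" "\<not> p c2" "\<not> p c3"
proof -
  have "\<exists>l. affine_fun l \<and> l b \<and> \<not> l c1 \<and> \<not> l c2"
  \<comment> \<open>A coordinate in which \<open>b\<close> differs from both points serves directly.
    Otherwise a coordinate separating \<open>b\<close> from \<open>c1\<close> does not see
    \<open>c2\<close>, and conversely, so the sum of two such coordinates works.\<close>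
  proof (cases "\<exists>i. c1 i \<noteq> b i \<and> c2 i \<noteq> b i")
    case True
    then obtain i where "c1 i \<noteq> b i" "c2 i \<noteq> b i" by blast
    moreover have "affine_fun (\<lambda>u. u i \<noteq> (\<not> b i))"
      by (intro affine_fun_add affine_fun_coord affine_fun_const)
    ultimately show ?thesis by (intro exI[of _ "\<lambda>u. u i \<noteq> (\<not> b i)"]) auto
  next
    case False
    obtain i j where ij: "b i \<noteq> c1 i" "b j \<noteq> c2 j"
      using assms unfolding fun_eq_iff by blast
    have "affine_fun (\<lambda>u. u i \<noteq> (u j \<noteq> (b i = b j)))"
      by (intro affine_fun_add affine_fun_coord affine_fun_const)
    moreover have "c2 i = b i" "c1 j = b j" using False ij by blast+
    ultimately show ?thesis
      using ij by (intro exI[of _ "\<lambda>u. u i \<noteq> (u j \<noteq> (b i = b j))"]) auto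
  qed
  then obtain l where l: "affine_fun l" "l b" "\<not> l c1" "\<not> l c2" by blast
  obtain i where i: "b i \<noteq> c3 i" using assms unfolding fun_eq_iff by blast
  have "affine_fun (\<lambda>u. u i \<noteq> (\<not> b i))"
    by (intro affine_fun_add affine_fun_coord affine_fun_const)
  from quadratic_mult_affine[OF l(1) this] show ?thesis
    using l i by (intro that[of "\<lambda>u. l u \<and> (u i \<noteq> (\<not> b i))"]) auto
qed

text \<open>An element \<open>F\<close> stands for the map that sends \<open>p\<close> to the vector \<open>\<lambda>j. F (p, j)\<close>. The model is
  the semidirect product by the translations of the argument of \<open>p\<close>.\<close>

type_synonym mod_elt = "(vec \<Rightarrow> bool) \<times> nat \<Rightarrow> bool"

text \<open>The action dual to translating polynomials: evaluation at a point \<open>a\<close>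
  becomes evaluation at \<open>a \<oplus>\<^sub>v w\<close>.\<close>

definition shift :: "vec \<Rightarrow> mod_elt \<Rightarrow> mod_elt" where
  "shift w F = (\<lambda>(p, j). F (\<lambda>u. p (u \<oplus>\<^sub>v w), j))"

definition model :: "(vec \<times> mod_elt) monoid" where
  "model = \<lparr>carrier = UNIV,
     monoid.mult = (\<lambda>(v, F) (w, F'). (v \<oplus>\<^sub>v w, shift w F \<oplus>\<^sub>v F')),
     one = (vzero, vzero)\<rparr>"

lemma carrier_model [simp]: "carrier model = UNIV"
  and mult_model [simp]: "(v, F) \<otimes>\<^bsub>model\<^esub> (w, F') = (v \<oplus>\<^sub>v w, shift w F \<oplus>\<^sub>v F')"
  and one_model [simp]: "\<one>\<^bsub>model\<^esub> = (vzero, vzero)"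
  by (simp_all add: model_def)

lemma shift_shift [simp]: "shift v (shift w F) = shift (v \<oplus>\<^sub>v w) F"
  by (simp add: shift_def case_prod_unfold vadd_assoc vadd_commute[of w v])

lemma shift_zero [simp]: "shift vzero F = F" "shift v vzero = vzero"
  by (auto simp: shift_def fun_eq_iff) (simp_all add: vzero_def)

lemma shift_add [simp]: "shift v (F \<oplus>\<^sub>v F') = shift v F \<oplus>\<^sub>v shift v F'"
  by (auto simp: shift_def fun_eq_iff vadd_def)

lemma group_model [simp]: "group model"
proof (rule groupI)
  fix x :: "vec \<times> mod_elt"
  obtain v F where "x = (v, F)" by force
  then show "\<exists>y\<in>carrier model. y \<otimes>\<^bsub>model\<^esub> x = \<one>\<^bsub>model\<^esub>"
    by (intro bexI[of _ "(v, shift v F)"]) auto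
qed (auto simp: vadd_ac)

lemma inv_model [simp]: "inv\<^bsub>model\<^esub> (v, F) = (v, shift v F)"
  by (intro group.inv_equality) auto

definition mX :: "vec \<Rightarrow> vec \<times> mod_elt" where
  "mX v = (v, vzero)"

text \<open>Evaluation at zero, tensored with \<open>w\<close>. The guard \<open>quadratic p\<close>
  forces the value to be false at all other \<open>p\<close>, so that third differences vanish at
  every argument although the model admits arbitrary functions.\<close>

definition mY :: "vec \<Rightarrow> vec \<times> mod_elt" where
  "mY w = (vzero, \<lambda>(p, j). quadratic p \<and> p vzero \<and> w j)"

abbreviation "mc \<equiv> group_comm model"

text \<open>Commutators inside either factor are trivial, and the commutator with the translation by
  \<open>v\<close> is the difference operator in direction \<open>v\<close>.\<close>

lemma mc_XX: "mc (v, vzero) (w, vzero) = (vzero, vzero)"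
  and mc_NN: "mc (vzero, F) (vzero, F') = (vzero, vzero)"
  and mc_NX: "mc (vzero, F) (v, vzero) = (vzero, F \<oplus>\<^sub>v shift v F)"
  and mc_XN: "mc (v, vzero) (vzero, F) = (vzero, F \<oplus>\<^sub>v shift v F)"
  by (simp_all add: group_comm_def vadd_ac)

text \<open>For quadratic \<open>p\<close> the eight terms are values of \<open>p\<close> on the
  cube spanned by \<open>a\<close>, \<open>b\<close>, \<open>c\<close> at zero, and the identity in
  \<open>quadratic\<close> applies. For other \<open>p\<close> every term is false, because
  translation preserves being quadratic.\<close>

lemma third_difference:
  assumes "F = (\<lambda>(p, j). quadratic p \<and> p vzero \<and> w j)"
  shows "(F \<oplus>\<^sub>v shift a F \<oplus>\<^sub>v shift b (F \<oplus>\<^sub>v shift a F)) \<oplus>\<^sub>v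
    shift c (F \<oplus>\<^sub>v shift a F \<oplus>\<^sub>v shift b (F \<oplus>\<^sub>v shift a F)) = vzero"
proof (rule ext, clarify)
  fix p j
  show "((F \<oplus>\<^sub>v shift a F \<oplus>\<^sub>v shift b (F \<oplus>\<^sub>v shift a F)) \<oplus>\<^sub>v
    shift c (F \<oplus>\<^sub>v shift a F \<oplus>\<^sub>v shift b (F \<oplus>\<^sub>v shift a F))) (p, j) = vzero (p, j)"
  proof (cases "quadratic p \<and> w j")
    case True
    from conjunct1[OF True, unfolded quadratic_def, rule_format, of vzero a b c]
    have "p vzero = (p a \<noteq> (p b \<noteq> (p c \<noteq> (p (a \<oplus>\<^sub>v b) \<noteq>
       (p (a \<oplus>\<^sub>v c) \<noteq> (p (b \<oplus>\<^sub>v c) \<noteq> p (a \<oplus>\<^sub>v b \<oplus>\<^sub>v c)))))))"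
      by (simp only: vadd_simps)
    moreover have "shift v F (p, j) = p v" for v
      using True by (simp add: assms shift_def)
    moreover have "F (p, j) = p vzero"
      using True by (simp add: assms)
    ultimately show ?thesis
      by (simp only: shift_add shift_shift vadd_apply vzero_apply vadd_ac) argo
  next
    case False
    then show ?thesis by (auto simp: assms shift_def vadd_apply vzero_apply)
  qed
qed

subsection \<open>The defining relations of the group\<close>

text \<open>The relators read as equations in an arbitrary group. With arbitrary sets
  \<open>X\<close> and \<open>Y\<close> the predicate covers both the generators and the whole
  subgroups they generate.\<close>

definition Hn_relations :: "('a, 'b) monoid_scheme \<Rightarrow> 'a set \<Rightarrow> 'a set \<Rightarrow> bool" where
  "Hn_relations G X Y \<longleftrightarrow> (let c = group_comm G; Z = X \<union> Y in
     (\<forall>z\<in>Z. z \<otimes>\<^bsub>G\<^esub> z = \<one>\<^bsub>G\<^esub>) \<and>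
     (\<forall>x\<in>X. \<forall>x'\<in>X. c x x' = \<one>\<^bsub>G\<^esub>) \<and>
     (\<forall>y\<in>Y. \<forall>y'\<in>Y. c y y' = \<one>\<^bsub>G\<^esub>) \<and>
     (\<forall>x\<in>X. \<forall>y\<in>Y. c x y \<otimes>\<^bsub>G\<^esub> c x y = \<one>\<^bsub>G\<^esub>) \<and>
     (\<forall>x\<in>X. \<forall>y\<in>Y. \<forall>y'\<in>Y. c (c y x) y' = \<one>\<^bsub>G\<^esub>) \<and>
     (\<forall>x\<in>X. \<forall>y\<in>Y. \<forall>z\<in>Z. c (c x y) z \<otimes>\<^bsub>G\<^esub> c (c x y) z = \<one>\<^bsub>G\<^esub>) \<and>
     (\<forall>z\<in>Z. \<forall>z'\<in>Z. \<forall>z''\<in>Z. \<forall>z'''\<in>Z. c (c (c z z') z'') z''' = \<one>\<^bsub>G\<^esub>))"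

lemma Hn_relationsI:
  assumes "\<And>z. z \<in> X \<union> Y \<Longrightarrow> z \<otimes>\<^bsub>G\<^esub> z = \<one>\<^bsub>G\<^esub>"
    and "\<And>x x'. x \<in> X \<Longrightarrow> x' \<in> X \<Longrightarrow> group_comm G x x' = \<one>\<^bsub>G\<^esub>"
    and "\<And>y y'. y \<in> Y \<Longrightarrow> y' \<in> Y \<Longrightarrow> group_comm G y y' = \<one>\<^bsub>G\<^esub>"
    and "\<And>x y. x \<in> X \<Longrightarrow> y \<in> Y \<Longrightarrow> group_comm G x y \<otimes>\<^bsub>G\<^esub> group_comm G x y = \<one>\<^bsub>G\<^esub>"
    and "\<And>x y y'. x \<in> X \<Longrightarrow> y \<in> Y \<Longrightarrow> y' \<in> Y \<Longrightarrow>
      group_comm G (group_comm G y x) y' = \<one>\<^bsub>G\<^esub>"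
    and "\<And>x y z. x \<in> X \<Longrightarrow> y \<in> Y \<Longrightarrow> z \<in> X \<union> Y \<Longrightarrow>
      group_comm G (group_comm G x y) z \<otimes>\<^bsub>G\<^esub> group_comm G (group_comm G x y) z = \<one>\<^bsub>G\<^esub>"
    and "\<And>z z' z'' w. z \<in> X \<union> Y \<Longrightarrow> z' \<in> X \<union> Y \<Longrightarrow> z'' \<in> X \<union> Y \<Longrightarrow> w \<in> X \<union> Y \<Longrightarrow>
      group_comm G (group_comm G (group_comm G z z') z'') w = \<one>\<^bsub>G\<^esub>"
  shows "Hn_relations G X Y"
  unfolding Hn_relations_def Let_def by (intro conjI ballI; fact assms)

lemma Hn_relationsD:
  assumes "Hn_relations G X Y"
  shows "z \<in> X \<union> Y \<Longrightarrow> z \<otimes>\<^bsub>G\<^esub> z = \<one>\<^bsub>G\<^esub>"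
    and "x \<in> X \<Longrightarrow> x' \<in> X \<Longrightarrow> group_comm G x x' = \<one>\<^bsub>G\<^esub>"
    and "y \<in> Y \<Longrightarrow> y' \<in> Y \<Longrightarrow> group_comm G y y' = \<one>\<^bsub>G\<^esub>"
    and "x \<in> X \<Longrightarrow> y \<in> Y \<Longrightarrow> group_comm G x y \<otimes>\<^bsub>G\<^esub> group_comm G x y = \<one>\<^bsub>G\<^esub>"
    and "x \<in> X \<Longrightarrow> y \<in> Y \<Longrightarrow> y' \<in> Y \<Longrightarrow> group_comm G (group_comm G y x) y' = \<one>\<^bsub>G\<^esub>"
    and "x \<in> X \<Longrightarrow> y \<in> Y \<Longrightarrow> z \<in> X \<union> Y \<Longrightarrow>
      group_comm G (group_comm G x y) z \<otimes>\<^bsub>G\<^esub> group_comm G (group_comm G x y) z = \<one>\<^bsub>G\<^esub>"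
    and "z \<in> X \<union> Y \<Longrightarrow> z' \<in> X \<union> Y \<Longrightarrow> z'' \<in> X \<union> Y \<Longrightarrow> w \<in> X \<union> Y \<Longrightarrow>
      group_comm G (group_comm G (group_comm G z z') z'') w = \<one>\<^bsub>G\<^esub>"
  using assms by (simp_all only: Hn_relations_def Let_def)

lemma Hn_relations_mono:
  assumes "Hn_relations G X Y" "X' \<subseteq> X" "Y' \<subseteq> Y"
  shows "Hn_relations G X' Y'"
proof -
  have "x \<in> X' \<Longrightarrow> x \<in> X" "y \<in> Y' \<Longrightarrow> y \<in> Y" "z \<in> X' \<union> Y' \<Longrightarrow> z \<in> X \<union> Y" for x y z
    using assms(2,3) by blast+
  note * = this Hn_relationsD[OF assms(1)]
  show ?thesis by (rule Hn_relationsI) (simp_all only: *)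
qed

lemma Hn_relators_words: "Hn_relators n \<subseteq> words (gens n)"
  by (auto simp: Hn_relators_def Let_def X0_words_def Y0_words_def gens_def)

lemma Hn_relators_mem:
  shows "z \<in> X0_words n \<union> Y0_words n \<Longrightarrow> z @ z \<in> Hn_relators n"
    and "x \<in> X0_words n \<Longrightarrow> x' \<in> X0_words n \<Longrightarrow> word_comm x x' \<in> Hn_relators n"
    and "y \<in> Y0_words n \<Longrightarrow> y' \<in> Y0_words n \<Longrightarrow> word_comm y y' \<in> Hn_relators n"
    and "x \<in> X0_words n \<Longrightarrow> y \<in> Y0_words n \<Longrightarrow> word_comm x y @ word_comm x y \<in> Hn_relators n"
    and "x \<in> X0_words n \<Longrightarrow> y \<in> Y0_words n \<Longrightarrow> y' \<in> Y0_words n \<Longrightarrow>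
      word_comm (word_comm y x) y' \<in> Hn_relators n"
    and "x \<in> X0_words n \<Longrightarrow> y \<in> Y0_words n \<Longrightarrow> z \<in> X0_words n \<union> Y0_words n \<Longrightarrow>
      word_comm (word_comm x y) z @ word_comm (word_comm x y) z \<in> Hn_relators n"
    and "z \<in> X0_words n \<union> Y0_words n \<Longrightarrow> z' \<in> X0_words n \<union> Y0_words n \<Longrightarrow>
      z'' \<in> X0_words n \<union> Y0_words n \<Longrightarrow> w \<in> X0_words n \<union> Y0_words n \<Longrightarrow>
      word_comm (word_comm (word_comm z z') z'') w \<in> Hn_relators n"
  unfolding Hn_relators_def Let_def by blast+

text \<open>Evaluation turns concatenation into products and \<open>word_comm\<close> into
  \<open>group_comm\<close>. One direction gives the relations in the presented group, the other the
  hypothesis of von Dyck's theorem.\<close>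

lemma (in group) word_eval_Hn_relators:
  assumes f: "f ` gens n \<subseteq> carrier G"
  shows "(\<forall>r\<in>Hn_relators n. word_eval G f r = \<one>) \<longleftrightarrow>
    Hn_relations G ((\<lambda>i. f (Xgen i)) ` {1..n}) ((\<lambda>i. f (Ygen i)) ` {1..n})"
proof -
  let ?Z = "X0_words n \<union> Y0_words n" and ?e = "word_eval G f"
  have w: "u \<in> X0_words n \<Longrightarrow> u \<in> words (gens n)" "u \<in> Y0_words n \<Longrightarrow> u \<in> words (gens n)" for u
    by (auto simp: X0_words_def Y0_words_def gens_def)
  have fc: "f (Xgen i) \<in> carrier G" "f (Ygen i) \<in> carrier G" if "i \<in> {1..n}" for i
    using f that by (auto simp: gens_def)
  have X: "(\<lambda>i. f (Xgen i)) ` {1..n} = ?e ` X0_words n"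
    using fc by (force simp: X0_words_def image_iff)
  have Y: "(\<lambda>i. f (Ygen i)) ` {1..n} = ?e ` Y0_words n"
    using fc by (force simp: Y0_words_def image_iff)
  have Z: "?e ` X0_words n \<union> ?e ` Y0_words n = ?e ` ?Z" by blast
  have ev: "?e (u @ v) = ?e u \<otimes> ?e v" "?e (word_comm u v) = group_comm G (?e u) (?e v)"
    if "u \<in> words (gens n)" "v \<in> words (gens n)" for u v
    using that word_eval_append[OF f] word_eval_comm[OF f] by auto
  have wZ: "u \<in> words (gens n)" if "u \<in> ?Z" for u using that w by blast
  note R = Hn_relators_def[of n, unfolded Let_def]
  note M = Hn_relators_mem[where n = n]
  show ?thesis
  proof
    assume rel: "\<forall>r\<in>Hn_relators n. ?e r = \<one>"
    show "Hn_relations G ((\<lambda>i. f (Xgen i)) ` {1..n}) ((\<lambda>i. f (Ygen i)) ` {1..n})"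
      unfolding X Y
    proof -
      have N1: "?e z \<otimes> ?e z = \<one>" if "z \<in> ?Z" for z
        using rel[rule_format, OF M(1)[OF that]] that by (simp only: ev words_comm w wZ)
      have N2: "group_comm G (?e x) (?e x') = \<one>" if "x \<in> X0_words n" "x' \<in> X0_words n" for x x'
        using rel[rule_format, OF M(2)[OF that]] that by (simp only: ev words_comm w wZ)
      have N3: "group_comm G (?e y) (?e y') = \<one>" if "y \<in> Y0_words n" "y' \<in> Y0_words n" for y y'
        using rel[rule_format, OF M(3)[OF that]] that by (simp only: ev words_comm w wZ)
      have N4: "group_comm G (?e x) (?e y) \<otimes> group_comm G (?e x) (?e y) = \<one>" if "x \<in> X0_words n" "y \<in> Y0_words n" for x y
        using rel[rule_format, OF M(4)[OF that]] that by (simp only: ev words_comm w wZ)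
      have N5: "group_comm G (group_comm G (?e y) (?e x)) (?e y') = \<one>" if "x \<in> X0_words n" "y \<in> Y0_words n" "y' \<in> Y0_words n" for x y y'
        using rel[rule_format, OF M(5)[OF that]] that by (simp only: ev words_comm w wZ)
      have N6: "group_comm G (group_comm G (?e x) (?e y)) (?e z) \<otimes> group_comm G (group_comm G (?e x) (?e y)) (?e z) = \<one>" if "x \<in> X0_words n" "y \<in> Y0_words n" "z \<in> ?Z" for x y z
        using rel[rule_format, OF M(6)[OF that]] that by (simp only: ev words_comm w wZ)
      have N7: "group_comm G (group_comm G (group_comm G (?e z) (?e z')) (?e z'')) (?e u) = \<one>" if "z \<in> ?Z" "z' \<in> ?Z" "z'' \<in> ?Z" "u \<in> ?Z" for z z' z'' u
        using rel[rule_format, OF M(7)[OF that]] that by (simp only: ev words_comm w wZ)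
      show "Hn_relations G (?e ` X0_words n) (?e ` Y0_words n)"
        by (rule Hn_relationsI; (unfold Z)?; (elim imageE)?; hypsubst)
          (simp_all only: N1 N2 N3 N4 N5 N6 N7)
    qed
  next
    assume rel: "Hn_relations G ((\<lambda>i. f (Xgen i)) ` {1..n}) ((\<lambda>i. f (Ygen i)) ` {1..n})"
    note D = Hn_relationsD[OF rel[unfolded X Y], unfolded Z]
    show "\<forall>r\<in>Hn_relators n. ?e r = \<one>"
      unfolding R ball_Un
      by (intro conjI ballI; elim CollectE exE conjE; hypsubst)
        (simp_all only: ev words_comm w wZ D imageI simp_thms)
  qed
qed

lemma (in group_hom) hom_group_comm:
  "a \<in> carrier G \<Longrightarrow> b \<in> carrier G \<Longrightarrow> h (group_comm G a b) = group_comm H (h a) (h b)"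
  by (simp add: group_comm_def)

text \<open>Each relation says that some element is one, and an injective homomorphism reflects
  this. Relations can therefore be checked in the model.\<close>

lemma Hn_relations_inj_hom:
  assumes "group G" "group H" and h: "h \<in> hom G H" "inj_on h (carrier G)"
    and XY: "X \<subseteq> carrier G" "Y \<subseteq> carrier G"
    and rel: "Hn_relations H (h ` X) (h ` Y)"
  shows "Hn_relations G X Y"
proof -
  interpret group_hom G H h
    using assms by (simp add: group_hom_def group_hom_axioms_def)
  have one: "a = \<one>\<^bsub>G\<^esub> \<longleftrightarrow> h a = \<one>\<^bsub>H\<^esub>" if "a \<in> carrier G" for a
    using that inj_on_eq_iff[OF h(2) that G.one_closed] by simp
  have "h z \<in> h ` X \<union> h ` Y" "z \<in> carrier G" if "z \<in> X \<union> Y" for z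
    using that XY by blast+
  moreover have "h x \<in> h ` X" "x \<in> carrier G" if "x \<in> X" for x
    using that XY by blast+
  moreover have "h y \<in> h ` Y" "y \<in> carrier G" if "y \<in> Y" for y
    using that XY by blast+
  ultimately show ?thesis
    by (intro Hn_relationsI)
      (simp_all only: one hom_group_comm hom_mult G.m_closed G.group_comm_closed Hn_relationsD[OF rel])
qed

text \<open>A fourfold commutator is either trivial at an earlier stage or a third difference. The
  argument applies to all translations and to evaluation at zero with any \<open>w\<close>, not only
  to unit vectors.\<close>

lemma Hn_relations_model: "Hn_relations model (range mX) (range mY)"
proof -
  define F where "F w = (\<lambda>(p :: vec \<Rightarrow> bool, j :: nat). quadratic p \<and> p vzero \<and> w j)" for w
  have mY: "mY w = (vzero, F w)" for w by (simp add: mY_def F_def)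
  have cube: "(F w \<oplus>\<^sub>v shift a (F w) \<oplus>\<^sub>v shift b (F w \<oplus>\<^sub>v shift a (F w))) \<oplus>\<^sub>v
    shift c (F w \<oplus>\<^sub>v shift a (F w) \<oplus>\<^sub>v shift b (F w \<oplus>\<^sub>v shift a (F w))) = vzero" for w a b c
    by (rule third_difference) (simp add: F_def)
  have Z: "\<exists>v. z = (v, vzero) \<or> z = (vzero, F v)" if "z \<in> range mX \<union> range mY" for z
    using that by (auto simp: mX_def mY)
  show ?thesis
    by (rule Hn_relationsI; (drule Z)?)
      (auto simp: mX_def mY mc_XX mc_NN mc_NX mc_XN cube simp del: shift_add)
qed

subsection \<open>Normal forms\<close>

context group
begin

lemma group_comm_rule:
  "a \<in> carrier G \<Longrightarrow> b \<in> carrier G \<Longrightarrow> a \<otimes> b = b \<otimes> a \<otimes> group_comm G a b"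
  by (simp add: group_comm_def flip: m_assoc) (simp add: m_assoc flip: m_assoc[of b] m_assoc[of a])

lemma group_comm_eq_one_iff:
  assumes "a \<in> carrier G" "b \<in> carrier G"
  shows "group_comm G a b = \<one> \<longleftrightarrow> a \<otimes> b = b \<otimes> a"
proof
  assume "group_comm G a b = \<one>"
  then show "a \<otimes> b = b \<otimes> a" using assms group_comm_rule[OF assms] by simp
next
  assume "a \<otimes> b = b \<otimes> a"
  then have "b \<otimes> a \<otimes> group_comm G a b = b \<otimes> a \<otimes> \<one>"
    using assms group_comm_rule[OF assms] by simp
  then show "group_comm G a b = \<one>" using assms by (subst (asm) Units_l_cancel) auto
qed

lemma group_comm_swap:
  "a \<in> carrier G \<Longrightarrow> b \<in> carrier G \<Longrightarrow> group_comm G b a = inv (group_comm G a b)"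
  by (simp add: group_comm_def inv_mult_group m_assoc)

end

definition unit_vec :: "nat \<Rightarrow> vec" where
  "unit_vec i = (\<lambda>k. k = i)"

text \<open>The facts about the presented group on which the rest is built: generation and relations
  bound it from above, \<open>\<phi>\<close> bounds it from below, and \<open>lift\<close>, the
  universal property for maps into the group itself, supplies endomorphisms.\<close>

locale Hn_presented = group G for G :: "'a monoid" (structure) +
  fixes n :: nat and x y :: "nat \<Rightarrow> 'a" and \<phi> :: "'a \<Rightarrow> vec \<times> mod_elt"
  assumes x_closed [simp]: "i \<in> {1..n} \<Longrightarrow> x i \<in> carrier G"
    and y_closed [simp]: "i \<in> {1..n} \<Longrightarrow> y i \<in> carrier G"
    and generated: "carrier G = generate G (x ` {1..n} \<union> y ` {1..n})"
    and relations: "Hn_relations G (x ` {1..n}) (y ` {1..n})"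
    and \<phi>_hom: "\<phi> \<in> hom G model"
    and \<phi>_x: "i \<in> {1..n} \<Longrightarrow> \<phi> (x i) = mX (unit_vec i)"
    and \<phi>_y: "i \<in> {1..n} \<Longrightarrow> \<phi> (y i) = mY (unit_vec i)"
    and lift: "\<lbrakk>x' ` {1..n} \<subseteq> carrier G; y' ` {1..n} \<subseteq> carrier G;
        Hn_relations G (x' ` {1..n}) (y' ` {1..n})\<rbrakk> \<Longrightarrow>
      \<exists>h\<in>hom G G. \<forall>i\<in>{1..n}. h (x i) = x' i \<and> h (y i) = y' i"
begin

abbreviation "I \<equiv> {1..n}"

sublocale \<phi>: group_hom G model \<phi>
  by (simp add: group_hom_def group_hom_axioms_def is_group \<phi>_hom)

definition c :: "nat \<Rightarrow> nat \<Rightarrow> 'a" where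
  "c i j = group_comm G (x i) (y j)"

definition d :: "nat \<Rightarrow> nat \<Rightarrow> nat \<Rightarrow> 'a" where
  "d i j k = group_comm G (c i j) (x k)"

lemma c_closed [simp]: "i \<in> I \<Longrightarrow> j \<in> I \<Longrightarrow> c i j \<in> carrier G"
  by (simp add: c_def)

lemma d_closed [simp]: "i \<in> I \<Longrightarrow> j \<in> I \<Longrightarrow> k \<in> I \<Longrightarrow> d i j k \<in> carrier G"
  by (simp add: d_def)

lemma xx: "i \<in> I \<Longrightarrow> x i \<otimes> x i = \<one>"
  and yy: "i \<in> I \<Longrightarrow> y i \<otimes> y i = \<one>"
  and cc: "i \<in> I \<Longrightarrow> j \<in> I \<Longrightarrow> c i j \<otimes> c i j = \<one>"
  and dd: "i \<in> I \<Longrightarrow> j \<in> I \<Longrightarrow> k \<in> I \<Longrightarrow> d i j k \<otimes> d i j k = \<one>"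
  unfolding c_def d_def by (rule Hn_relationsD[OF relations]; blast)+

lemma inv_x: "i \<in> I \<Longrightarrow> inv (x i) = x i"
  and inv_y: "i \<in> I \<Longrightarrow> inv (y i) = y i"
  and inv_c: "i \<in> I \<Longrightarrow> j \<in> I \<Longrightarrow> inv (c i j) = c i j"
  by (rule inv_equality; simp add: xx yy cc)+

lemma x_commute: "i \<in> I \<Longrightarrow> j \<in> I \<Longrightarrow> x i \<otimes> x j = x j \<otimes> x i"
  and y_commute: "i \<in> I \<Longrightarrow> j \<in> I \<Longrightarrow> y i \<otimes> y j = y j \<otimes> y i"
  using Hn_relationsD(2,3)[OF relations] by (simp_all flip: group_comm_eq_one_iff)

text \<open>Reversing a commutator inverts it, and \<open>c i j\<close> is an involution.\<close>

lemma yx: "i \<in> I \<Longrightarrow> j \<in> I \<Longrightarrow> y j \<otimes> x i = x i \<otimes> y j \<otimes> c i j"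
  and yx_comm: "i \<in> I \<Longrightarrow> j \<in> I \<Longrightarrow> group_comm G (y j) (x i) = c i j"
proof -
  assume ij: "i \<in> I" "j \<in> I"
  have "group_comm G (y j) (x i) = inv (c i j)"
    using ij by (simp add: group_comm_swap[of "x i"] c_def)
  also have "\<dots> = c i j"
    using ij by (simp add: inv_c)
  finally show "group_comm G (y j) (x i) = c i j" .
  then show "y j \<otimes> x i = x i \<otimes> y j \<otimes> c i j"
    using ij group_comm_rule[of "y j" "x i"] by simp
qed

lemma cy: "i \<in> I \<Longrightarrow> j \<in> I \<Longrightarrow> k \<in> I \<Longrightarrow> c i j \<otimes> y k = y k \<otimes> c i j"
  using Hn_relationsD(5)[OF relations, of "x i" "y j" "y k"]
  by (simp add: yx_comm flip: group_comm_eq_one_iff)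

lemma cx: "i \<in> I \<Longrightarrow> j \<in> I \<Longrightarrow> k \<in> I \<Longrightarrow> c i j \<otimes> x k = x k \<otimes> c i j \<otimes> d i j k"
  unfolding d_def by (intro group_comm_rule) auto

text \<open>Fourfold commutators of generators are trivial, so all generators lie in the centralizer
  of \<open>d i j k\<close>.\<close>

lemma d_central:
  assumes "i \<in> I" "j \<in> I" "k \<in> I" "h \<in> carrier G"
  shows "h \<otimes> d i j k = d i j k \<otimes> h"
proof -
  have "d i j k \<otimes> z = z \<otimes> d i j k" if "z \<in> x ` I \<union> y ` I" for z
  proof -
    have "group_comm G (d i j k) z = \<one>"
      unfolding d_def c_def using assms that by (intro Hn_relationsD(7)[OF relations]) auto
    then show ?thesis using assms that by (subst (asm) group_comm_eq_one_iff) auto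
  qed
  then have "x ` I \<union> y ` I \<subseteq> {z \<in> carrier G. \<forall>s\<in>{d i j k}. z \<otimes> s = s \<otimes> z}"
    by auto
  from generate_subgroup_incl[OF this subgroup_centralizer]
  have "carrier G \<subseteq> {z \<in> carrier G. \<forall>s\<in>{d i j k}. z \<otimes> s = s \<otimes> z}"
    using assms(1-3) by (simp only: generated[symmetric] d_closed insert_subset empty_subsetI simp_thms)
  then show ?thesis using assms(4) by blast
qed

text \<open>\<open>c k l\<close> is the square of \<open>x k \<otimes> y l\<close>. Moving that
  product past \<open>c i j\<close> costs a central factor \<open>d i j k\<close>; moving the square
  costs it twice, and it is an involution.\<close>

lemma c_commute:
  assumes "i \<in> I" "j \<in> I" "k \<in> I" "l \<in> I"
  shows "c i j \<otimes> c k l = c k l \<otimes> c i j"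
proof -
  note [simp] = assms[simplified]
  let ?z = "x k \<otimes> y l" and ?d = "d i j k"
  have ckl: "c k l = ?z \<otimes> ?z"
    by (simp add: c_def group_comm_def m_assoc inv_x inv_y)
  \<comment> \<open>Only \<open>x k\<close> contributes the factor, since \<open>c i j\<close>
    commutes with \<open>y l\<close>.\<close>
  have step: "c i j \<otimes> ?z = ?z \<otimes> c i j \<otimes> ?d"
  proof -
    have "c i j \<otimes> ?z = x k \<otimes> c i j \<otimes> ?d \<otimes> y l"
      by (simp add: cx flip: m_assoc)
    also have "\<dots> = x k \<otimes> (c i j \<otimes> y l) \<otimes> ?d"
      by (simp add: m_assoc d_central[of i j k "y l"])
    finally show ?thesis by (simp add: cy m_assoc)
  qed
  have *: "c i j \<otimes> (z \<otimes> z) = z \<otimes> z \<otimes> c i j" if z: "z \<in> carrier G" "c i j \<otimes> z = z \<otimes> c i j \<otimes> ?d" for z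
  proof -
    have "c i j \<otimes> (z \<otimes> z) = z \<otimes> c i j \<otimes> ?d \<otimes> z"
      using z(1) by (simp flip: m_assoc add: z(2))
    also have "\<dots> = z \<otimes> (c i j \<otimes> z) \<otimes> ?d"
      using z(1) d_central[of i j k z] by (simp add: m_assoc)
    also have "\<dots> = z \<otimes> z \<otimes> c i j \<otimes> (?d \<otimes> ?d)"
      unfolding z(2) using z(1) by (simp add: m_assoc)
    finally show ?thesis using z(1) by (simp add: dd)
  qed
  show ?thesis unfolding ckl by (rule *[OF _ step]) simp
qed

text \<open>As an involution, \<open>c i j\<close> is both
  \<open>x i \<otimes> y j \<otimes> x i \<otimes> y j\<close> and the same product with
  \<open>x i\<close> and \<open>y j\<close> exchanged. Multiplying the first form by
  \<open>x i\<close> on the right gives the second multiplied by \<open>x i\<close> on the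
  left.\<close>

lemma d_diag:
  assumes "i \<in> I" "j \<in> I"
  shows "d i j i = \<one>"
proof -
  note [simp] = assms[simplified]
  have ckl: "c i j = x i \<otimes> y j \<otimes> x i \<otimes> y j"
    by (simp add: c_def group_comm_def inv_x inv_y)
  have "inv (c i j) = c i j" by (simp add: inv_c)
  then have c': "c i j = y j \<otimes> x i \<otimes> y j \<otimes> x i"
    by (simp add: ckl inv_mult_group m_assoc inv_x inv_y)
  have "c i j \<otimes> x i = x i \<otimes> (y j \<otimes> x i \<otimes> y j \<otimes> x i)"
    unfolding ckl by (simp add: m_assoc)
  also have "\<dots> = x i \<otimes> c i j" using c' by simp
  finally show ?thesis by (simp add: d_def group_comm_eq_one_iff)
qed

text \<open>Move \<open>y j\<close> past \<open>x i \<otimes> x k\<close> and past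
  \<open>x k \<otimes> x i\<close>. These products are equal, and the two results differ only in the
  last factor.\<close>

lemma d_sym:
  assumes "i \<in> I" "j \<in> I" "k \<in> I"
  shows "d i j k = d k j i"
proof -
  note [simp] = assms[simplified]
  have *: "y j \<otimes> (x i \<otimes> x k) = x i \<otimes> x k \<otimes> y j \<otimes> (c k j \<otimes> c i j) \<otimes> d i j k"
    if "i \<in> I" "k \<in> I" for i k
  proof -
    have "y j \<otimes> (x i \<otimes> x k) = x i \<otimes> y j \<otimes> (c i j \<otimes> x k)"
      using that yx[of i j] by (simp flip: m_assoc)
    also have "\<dots> = x i \<otimes> (y j \<otimes> x k) \<otimes> c i j \<otimes> d i j k"
      using that by (simp add: cx m_assoc)
    also have "\<dots> = x i \<otimes> x k \<otimes> y j \<otimes> (c k j \<otimes> c i j) \<otimes> d i j k"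
      using that by (simp add: yx m_assoc)
    finally show ?thesis .
  qed
  have "x i \<otimes> x k \<otimes> y j \<otimes> (c k j \<otimes> c i j) \<otimes> d i j k = x i \<otimes> x k \<otimes> y j \<otimes> (c k j \<otimes> c i j) \<otimes> d k j i"
    using *[of i k] *[of k i] by (simp add: x_commute[of k i] c_commute[of i j k j])
  then show ?thesis by simp
qed

end

definition monomial :: "nat set \<Rightarrow> vec \<Rightarrow> bool" where
  "monomial S = (\<lambda>u. \<forall>i\<in>S. u i)"

lemma quadratic_monomial:
  assumes "finite S" "card S \<le> 2"
  shows "quadratic (monomial S)"
proof -
  have "S = {} \<or> (\<exists>i. S = {i}) \<or> (\<exists>i k. S = {i, k})"
    using assms by (auto simp: le_Suc_eq numeral_2_eq_2 card_Suc_eq)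
  then show ?thesis
  proof (elim disjE exE)
    assume "S = {}"
    then show ?thesis
      using quadratic_mult_affine[OF affine_fun_const[of True] affine_fun_const[of True]]
      by (simp add: monomial_def)
  next
    fix i assume "S = {i}"
    then show ?thesis
      using quadratic_mult_affine[OF affine_fun_coord[of i] affine_fun_coord[of i]]
      by (simp add: monomial_def)
  next
    fix i k assume "S = {i, k}"
    then show ?thesis
      using quadratic_mult_affine[OF affine_fun_coord[of i] affine_fun_coord[of k]]
      by (simp add: monomial_def)
  qed
qed

section \<open>The elementary abelian subgroup \<open>N\<close> and the factorization of the
  group\<close>

context Hn_presented
begin

definition X :: "'a set" where "X = generate G (x ` I)"
definition Y :: "'a set" where "Y = generate G (y ` I)"

text \<open>A pair \<open>(S, j)\<close> stands for the monomial in the variables from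
  \<open>S\<close>, of degree at most two, and the coordinate \<open>j\<close>. It indexes the
  generators \<open>t\<close> of \<open>N\<close> as well as the dual characters.\<close>

definition basis :: "(nat set \<times> nat) set" where
  "basis = {S. S \<subseteq> I \<and> card S \<le> 2} \<times> I"

text \<open>\<open>Min\<close> and \<open>Max\<close> recover the elements of \<open>S\<close>. A
  two-element set thus gets its double commutator in increasing order; by \<open>d_sym\<close> the
  other order has the same value.\<close>

definition t :: "nat set \<times> nat \<Rightarrow> 'a" where
  "t = (\<lambda>(S, j). if S = {} then y j else if card S = 1 then c (Min S) j else d (Min S) j (Max S))"

definition N :: "'a set" where "N = generate G (t ` basis)"

lemma t_simps [simp]:
  "t ({}, j) = y j" "t ({i}, j) = c i j" "i < k \<Longrightarrow> t ({i, k}, j) = d i j k"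
  by (auto simp: t_def)

lemma basis_cases:
  assumes "b \<in> basis"
  obtains (y) j where "j \<in> I" "b = ({}, j)" | (c) i j where "i \<in> I" "j \<in> I" "b = ({i}, j)"
    | (d) i j k where "i \<in> I" "j \<in> I" "k \<in> I" "i < k" "b = ({i, k}, j)"
proof -
  obtain S j where b: "b = (S, j)" "S \<subseteq> I" "card S \<le> 2" "j \<in> I"
    using assms by (auto simp: basis_def)
  then have "finite S" using finite_subset by blast
  then have "S = {} \<or> (\<exists>i. S = {i}) \<or> (\<exists>i k. S = {i, k} \<and> i \<noteq> k)"
    using b(3) by (auto simp: le_Suc_eq numeral_2_eq_2 card_Suc_eq)
  then show thesis
  proof (elim disjE exE conjE)
    fix i k assume S: "S = {i, k}" "i \<noteq> k"
    then show thesis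
      using d[of i j k] d[of k j i] b by (cases "i < k") (auto simp: insert_commute)
  qed (use b y c in auto)
qed

lemma in_basis:
  "j \<in> I \<Longrightarrow> ({}, j) \<in> basis" "i \<in> I \<Longrightarrow> j \<in> I \<Longrightarrow> ({i}, j) \<in> basis"
  "i \<in> I \<Longrightarrow> j \<in> I \<Longrightarrow> k \<in> I \<Longrightarrow> ({i, k}, j) \<in> basis"
  by (auto simp: basis_def card_insert_if)

lemma finite_basis: "finite basis"
  by (auto simp: basis_def)

lemma card_basis: "card basis = (1 + n + (n choose 2)) * n"
proof -
  let ?K = "\<lambda>k. {S. S \<subseteq> I \<and> card S = k}"
  have "{S. S \<subseteq> I \<and> card S \<le> 2} = ?K 0 \<union> ?K 1 \<union> ?K 2" by auto
  moreover have fin: "finite (?K k)" for k by auto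
  moreover have "card (?K k) = n choose k" for k using n_subsets[of I k] by simp
  ultimately have "card {S. S \<subseteq> I \<and> card S \<le> 2} = 1 + n + (n choose 2)"
    by (simp only:) (subst card_Un_disjoint; (subst card_Un_disjoint)?; auto)
  then show ?thesis by (simp add: basis_def card_cartesian_product)
qed

lemma t_closed [simp]: "b \<in> basis \<Longrightarrow> t b \<in> carrier G"
  by (erule basis_cases) auto

lemma t_involution: "b \<in> basis \<Longrightarrow> t b \<otimes> t b = \<one>"
  by (erule basis_cases) (simp_all add: yy cc dd)

lemma t_commute:
  assumes "a \<in> basis" "b \<in> basis"
  shows "t a \<otimes> t b = t b \<otimes> t a"
proof -
  have central: "h \<otimes> t ({i, k}, j) = t ({i, k}, j) \<otimes> h"
    if "i \<in> I" "j \<in> I" "k \<in> I" "i < k" "h \<in> carrier G" for i j k h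
    using d_central[of i j k h] that by simp
  from assms show ?thesis
    by (elim basis_cases; hypsubst)
      (simp_all only: t_simps, (rule y_commute cy cy[symmetric] c_commute d_central d_central[symmetric]; simp)+)
qed

lemma subgroup_X: "subgroup X G" and subgroup_Y: "subgroup Y G" and subgroup_N: "subgroup N G"
  unfolding X_def Y_def N_def by (rule generate_is_subgroup; auto)+

lemma y_in_N: "j \<in> I \<Longrightarrow> y j \<in> N"
  and c_in_N: "i \<in> I \<Longrightarrow> j \<in> I \<Longrightarrow> c i j \<in> N"
  unfolding N_def using in_basis t_simps by (metis generate.incl image_eqI)+

text \<open>Increasing indices are covered by \<open>basis\<close>; equal ones are settled by
  \<open>d_diag\<close>, decreasing ones by \<open>d_sym\<close>.\<close>

lemma d_in_N:
  assumes "i \<in> I" "j \<in> I" "k \<in> I"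
  shows "d i j k \<in> N"
proof -
  have *: "d i j k \<in> N" if "i \<in> I" "j \<in> I" "k \<in> I" "i < k" for i j k
    unfolding N_def using in_basis(3)[of i j k] t_simps(3)[of i k j] that by (metis generate.incl image_eqI)
  consider "i < k" | "i = k" | "k < i" by force
  then show ?thesis
  proof cases
    case 1
    then show ?thesis using assms by (rule_tac *)
  next
    case 2
    then show ?thesis using assms d_diag[of i j] subgroup.one_closed[OF subgroup_N] by simp
  next
    case 3
    then show ?thesis using assms *[of k j i] by (simp only: d_sym[of i j k])
  qed
qed

text \<open>Moving \<open>x k\<close> to the left past \<open>y j\<close> or \<open>c i j\<close>
  leaves behind \<open>c k j\<close> or \<open>d i j k\<close>, again in \<open>N\<close>, and the
  double commutators are central. The claim passes from generators to all of \<open>N\<close>, then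
  to all of \<open>X\<close>.\<close>

lemma N_normalized:
  assumes "a \<in> X" "m \<in> N"
  shows "\<exists>m'\<in>N. m \<otimes> a = a \<otimes> m'"
proof -
  interpret N: subgroup N G by (rule subgroup_N)
  have N_carrier [simp]: "m \<in> carrier G" if "m \<in> N" for m using that by simp
  have step: "\<exists>m'\<in>N. m \<otimes> x k = x k \<otimes> m'" if k: "k \<in> I" and m: "m \<in> N" for k m
  proof -
    have gen: "\<exists>m'\<in>N. t b \<otimes> x k = x k \<otimes> m'" if "b \<in> basis" for b
      using that
    proof (cases rule: basis_cases)
      case (y j)
      then show ?thesis using k yx[of k j] y_in_N c_in_N by (auto simp: m_assoc)
    next
      case (c i j)
      then show ?thesis using k cx[of i j k] c_in_N d_in_N by (auto simp: m_assoc)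
    next
      case (d i j k')
      then show ?thesis using k d_central[of i j k' "x k"] d_in_N by (metis t_simps(3) x_closed)
    qed
    show ?thesis
      using m unfolding N_def
    proof (induction)
      case one
      then show ?case using k by (auto intro!: bexI[of _ \<one>] generate.one)
    next
      case (incl m)
      then show ?case using gen unfolding N_def by blast
    next
      case (inv m)
      then obtain b where b: "b \<in> basis" "m = t b" by blast
      then have "inv m = t b" by (simp add: inv_equality t_involution)
      then show ?case using gen[OF b(1)] unfolding N_def by simp
    next
      case (eng m1 m2)
      then obtain m1' m2' where m': "m1' \<in> N" "m1 \<otimes> x k = x k \<otimes> m1'" "m2' \<in> N" "m2 \<otimes> x k = x k \<otimes> m2'"
        unfolding N_def by blast
      have m: "m1 \<in> carrier G" "m2 \<in> carrier G" using eng N_carrier by (simp_all flip: N_def)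
      have "m1 \<otimes> m2 \<otimes> x k = m1 \<otimes> x k \<otimes> m2'"
        using m m'(1,3,4) k by (simp add: m_assoc)
      also have "\<dots> = x k \<otimes> (m1' \<otimes> m2')"
        unfolding m'(2) using m m'(1,3) k by (simp add: m_assoc)
      finally show ?case using m' unfolding N_def by (blast intro: generate.eng)
    qed
  qed
  show ?thesis
    using assms unfolding X_def
  proof (induction arbitrary: m)
    case one
    then show ?case by auto
  next
    case (incl a)
    then show ?case using step by blast
  next
    case (inv a)
    then show ?case using step inv_x by auto
  next
    case (eng a b)
    then obtain m1 where m1: "m1 \<in> N" "m \<otimes> a = a \<otimes> m1" by blast
    with eng obtain m2 where m2: "m2 \<in> N" "m1 \<otimes> b = b \<otimes> m2" by blast
    have ab: "a \<in> carrier G" "b \<in> carrier G"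
      using eng(1,2) subgroup.mem_carrier[OF subgroup_X] unfolding X_def by blast+
    have "m \<otimes> (a \<otimes> b) = a \<otimes> (m1 \<otimes> b)"
      using ab m1 eng.prems by (simp flip: m_assoc)
    also have "\<dots> = a \<otimes> b \<otimes> m2" using ab m2 by (simp add: m_assoc)
    finally show ?case using m2 by blast
  qed
qed

text \<open>Each generator is an involution in \<open>X\<close> or in \<open>N\<close>; in a
  product, \<open>N_normalized\<close> moves the second \<open>X\<close>-factor to the left of the
  first \<open>N\<close>-factor. This gives the upper bound for the order.\<close>

lemma normal_form:
  assumes "h \<in> carrier G"
  obtains a m where "a \<in> X" "m \<in> N" "h = a \<otimes> m"
proof -
  interpret N: subgroup N G by (rule subgroup_N)
  interpret X: subgroup X G by (rule subgroup_X)
  have gen: "\<exists>a\<in>X. \<exists>m\<in>N. h = a \<otimes> m" if h: "h \<in> x ` I \<union> y ` I" for h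
  proof (cases "h \<in> x ` I")
    case True
    then have "h \<in> X" unfolding X_def by (rule generate.incl)
    then show ?thesis by (intro bexI[of _ h] bexI[of _ \<one>]) auto
  next
    case False
    then have "h \<in> N" using h y_in_N by blast
    then show ?thesis by (intro bexI[of _ \<one>] bexI[of _ h]) auto
  qed
  have "h \<in> generate G (x ` I \<union> y ` I)" using assms generated by simp
  then have "\<exists>a\<in>X. \<exists>m\<in>N. h = a \<otimes> m"
  proof induction
    case one
    then show ?case by (intro bexI[of _ \<one>]) auto
  next
    case (incl h)
    then show ?case by (rule gen)
  next
    case (inv h)
    then have "inv h = h" using inv_x inv_y by blast
    then show ?case using gen[OF inv] by simp
  next
    case (eng h1 h2)
    then obtain a m b m2 where h: "a \<in> X" "m \<in> N" "h1 = a \<otimes> m" "b \<in> X" "m2 \<in> N" "h2 = b \<otimes> m2"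
      by blast
    from N_normalized[OF h(4,2)] obtain m' where m': "m' \<in> N" "m \<otimes> b = b \<otimes> m'" by blast
    have "h1 \<otimes> h2 = a \<otimes> (m \<otimes> b) \<otimes> m2" using h by (simp add: m_assoc)
    also have "\<dots> = a \<otimes> b \<otimes> (m' \<otimes> m2)" unfolding m'(2) using h m'(1) by (simp add: m_assoc)
    finally show ?case using h m' by blast
  qed
  then show ?thesis using that by blast
qed

end

section \<open>Images in the model and injectivity of \<open>\<phi>\<close>\<close>

lemma mX_mult: "mX v \<otimes>\<^bsub>model\<^esub> mX w = mX (v \<oplus>\<^sub>v w)"
  and mY_mult: "mY v \<otimes>\<^bsub>model\<^esub> mY w = mY (v \<oplus>\<^sub>v w)"
  by (auto simp: mX_def mY_def vadd_apply fun_eq_iff)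

lemma mX_zero: "mX vzero = \<one>\<^bsub>model\<^esub>" and mY_zero: "mY vzero = \<one>\<^bsub>model\<^esub>"
  by (auto simp: mX_def mY_def vzero_apply fun_eq_iff)

context Hn_presented
begin

lemma \<phi>_X: "a \<in> X \<Longrightarrow> \<phi> a = mX (fst (\<phi> a))"
proof -
  assume "a \<in> X"
  then have "\<exists>v. \<phi> a = mX v"
    unfolding X_def
  proof induction
    case one
    then show ?case using mX_zero by (metis \<phi>.hom_one)
  next
    case (incl h)
    then show ?case using \<phi>_x by auto
  next
    case (inv h)
    then show ?case using \<phi>_x inv_x by auto
  next
    case (eng h1 h2)
    then have "h1 \<in> carrier G" "h2 \<in> carrier G"
      using subgroup.mem_carrier[OF subgroup_X] by (auto simp: X_def)
    then show ?case using eng by (auto simp: mX_mult)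
  qed
  then show ?thesis by (auto simp: mX_def)
qed

lemma \<phi>_Y: "a \<in> Y \<Longrightarrow> \<exists>w. \<phi> a = mY w"
  unfolding Y_def
proof (induction rule: generate.induct)
  case one
  then show ?case using mY_zero by (metis \<phi>.hom_one)
next
  case (incl h)
  then show ?case using \<phi>_y by auto
next
  case (inv h)
  then show ?case using \<phi>_y inv_y by auto
next
  case (eng h1 h2)
  then have "h1 \<in> carrier G" "h2 \<in> carrier G"
    using subgroup.mem_carrier[OF subgroup_Y] by (auto simp: Y_def)
  then show ?case using eng by (auto simp: mY_mult)
qed

text \<open>The second component of \<open>mY (unit_vec j)\<close>.\<close>

definition unit_fun :: "nat \<Rightarrow> mod_elt" where
  "unit_fun j = (\<lambda>(p, l). quadratic p \<and> p vzero \<and> l = j)"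

lemma \<phi>_y': "j \<in> I \<Longrightarrow> \<phi> (y j) = (vzero, unit_fun j)"
  by (simp only: \<phi>_y) (simp add: mY_def unit_fun_def unit_vec_def)

lemma \<phi>_c: "i \<in> I \<Longrightarrow> j \<in> I \<Longrightarrow> \<phi> (c i j) = (vzero, unit_fun j \<oplus>\<^sub>v shift (unit_vec i) (unit_fun j))"
  unfolding c_def by (simp add: \<phi>.hom_group_comm \<phi>_x \<phi>_y' mX_def mc_XN)

lemma \<phi>_d: "i \<in> I \<Longrightarrow> j \<in> I \<Longrightarrow> k \<in> I \<Longrightarrow> \<phi> (d i j k) = (vzero,
    unit_fun j \<oplus>\<^sub>v shift (unit_vec i) (unit_fun j) \<oplus>\<^sub>v
    shift (unit_vec k) (unit_fun j \<oplus>\<^sub>v shift (unit_vec i) (unit_fun j)))"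
  unfolding d_def by (simp add: \<phi>.hom_group_comm \<phi>_c \<phi>_x mX_def mc_NX del: shift_add)

text \<open>The monomial \<open>T\<close>, evaluated at the indicator of a set \<open>A\<close>,
  tests whether \<open>T \<subseteq> A\<close>. The image of \<open>t (S, j)\<close> sums the
  evaluations at the indicators of all subsets of \<open>S\<close>, so Moebius inversion leaves
  exactly \<open>T = S\<close>.\<close>

lemma snd_\<phi>_t:
  assumes "b \<in> basis" "(T, l) \<in> basis"
  shows "snd (\<phi> (t b)) (monomial T, l) \<longleftrightarrow> b = (T, l)"
proof -
  have T: "quadratic (monomial T)"
    using assms(2) finite_subset[of T I] by (auto simp: basis_def intro!: quadratic_monomial)
  have u: "unit_fun j (monomial T, m) \<longleftrightarrow> T = {} \<and> m = j" for j m
    using T by (auto simp: unit_fun_def monomial_def vzero_apply)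
  have sh: "shift v (unit_fun j) (monomial T, m) \<longleftrightarrow> T \<subseteq> {i. v i} \<and> m = j" for v j m
    using T by (auto simp: shift_def unit_fun_def) (auto simp: monomial_def)
  have uv: "{l. unit_vec i l} = {i}" for i by (auto simp: unit_vec_def)
  have uv2: "{l. (unit_vec k \<oplus>\<^sub>v unit_vec i) l} = {i, k}" if "i < k" for i k
    using that by (auto simp: unit_vec_def vadd_apply)
  have sh1: "shift (unit_vec i) (unit_fun j) (monomial T, m) \<longleftrightarrow> T \<subseteq> {i} \<and> m = j" for i j m
    by (simp only: sh uv)
  have sh2: "shift (unit_vec k \<oplus>\<^sub>v unit_vec i) (unit_fun j) (monomial T, m) \<longleftrightarrow> T \<subseteq> {i, k} \<and> m = j"
    if "i < k" for i j k m
    using that by (simp only: sh uv2)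
  from assms(1) show ?thesis
  proof (cases rule: basis_cases)
    case (y j)
    then show ?thesis by (auto simp: \<phi>_y' u)
  next
    case (c i j)
    then show ?thesis by (auto simp: \<phi>_c u sh1 vadd_apply)
  next
    case (d i j k)
    then have "snd (\<phi> (t b)) (monomial T, l) \<longleftrightarrow> l = j \<and>
        (((T = {}) \<noteq> (T \<subseteq> {i})) \<noteq> ((T \<subseteq> {k}) \<noteq> (T \<subseteq> {i, k})))"
      by (cases "l = j") (simp_all add: \<phi>_d u sh1 sh2 vadd_apply)
    also have "\<dots> \<longleftrightarrow> l = j \<and> T = {i, k}"
    proof -
      have "T \<subseteq> {i, k} \<longleftrightarrow> T = {} \<or> T = {i} \<or> T = {k} \<or> T = {i, k}" by auto
      then show ?thesis using \<open>i < k\<close> by (auto simp: subset_singleton_iff doubleton_eq_iff)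
    qed
    finally show ?thesis using d by auto
  qed
qed

lemma N_carrier: "m \<in> N \<Longrightarrow> m \<in> carrier G"
  and X_carrier: "m \<in> X \<Longrightarrow> m \<in> carrier G"
  and Y_carrier: "m \<in> Y \<Longrightarrow> m \<in> carrier G"
  using subgroup.mem_carrier[OF subgroup_N] subgroup.mem_carrier[OF subgroup_X]
    subgroup.mem_carrier[OF subgroup_Y] by auto

lemma fst_\<phi>_mult: "a \<in> carrier G \<Longrightarrow> b \<in> carrier G \<Longrightarrow> fst (\<phi> (a \<otimes> b)) = fst (\<phi> a) \<oplus>\<^sub>v fst (\<phi> b)"
  by (cases "\<phi> a"; cases "\<phi> b") simp

lemma fst_\<phi>_N: "m \<in> N \<Longrightarrow> fst (\<phi> m) = vzero"
proof -
  have gen: "fst (\<phi> (t b)) = vzero" if "b \<in> basis" for b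
    using that by (cases rule: basis_cases) (auto simp: \<phi>_y' \<phi>_c \<phi>_d)
  assume "m \<in> N"
  then show ?thesis
    unfolding N_def
  proof induction
    case one
    then show ?case using \<phi>.hom_one by simp
  next
    case (incl h)
    then show ?case using gen by auto
  next
    case (inv h)
    then obtain b where b: "b \<in> basis" "h = t b" by blast
    then have "inv h = t b" by (simp add: inv_equality t_involution)
    then show ?case using gen b by simp
  next
    case (eng h1 h2)
    then have "h1 \<in> carrier G" "h2 \<in> carrier G" using N_carrier by (auto simp: N_def)
    then show ?case using eng by (simp add: fst_\<phi>_mult del: \<phi>.hom_mult)
  qed
qed

lemma snd_\<phi>_mult:
  assumes "a \<in> carrier G" "b \<in> carrier G" "fst (\<phi> b) = vzero"
  shows "snd (\<phi> (a \<otimes> b)) = snd (\<phi> a) \<oplus>\<^sub>v snd (\<phi> b)"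
  using assms by (cases "\<phi> a"; cases "\<phi> b") simp

lemma Y_subset_N: "Y \<subseteq> N"
  unfolding Y_def using y_in_N by (intro generate_subgroup_incl subgroup_N) auto

text \<open>On \<open>N\<close> the first component of \<open>\<phi>\<close> vanishes, which makes
  the second component additive; duality is \<open>snd_\<phi>_t\<close>.\<close>

lemma C2_basis_N: "C2_basis (G\<lparr>carrier := N\<rparr>) basis t (\<lambda>(T, l) h. snd (\<phi> h) (monomial T, l))"
  unfolding N_def
proof (rule C2_basis_generate)
  fix i a b assume "i \<in> basis" and "a \<in> generate G (t ` basis)" "b \<in> generate G (t ` basis)"
  then have "a \<in> N" "b \<in> N" by (simp_all add: N_def)
  then show "(case i of (T, l) \<Rightarrow> \<lambda>h. snd (\<phi> h) (monomial T, l)) (a \<otimes> b) =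
      ((case i of (T, l) \<Rightarrow> \<lambda>h. snd (\<phi> h) (monomial T, l)) a \<noteq>
       (case i of (T, l) \<Rightarrow> \<lambda>h. snd (\<phi> h) (monomial T, l)) b)"
    using N_carrier fst_\<phi>_N by (cases i) (simp add: snd_\<phi>_mult vadd_apply del: \<phi>.hom_mult)
qed (auto simp: finite_basis t_commute t_involution snd_\<phi>_t)

lemma C2_basis_X: "C2_basis (G\<lparr>carrier := X\<rparr>) I x (\<lambda>i h. fst (\<phi> h) i)"
  unfolding X_def
proof (rule C2_basis_generate)
  fix i a b assume "a \<in> generate G (x ` I)" "b \<in> generate G (x ` I)"
  then have "a \<in> X" "b \<in> X" by (simp_all add: X_def)
  then show "fst (\<phi> (a \<otimes> b)) i = (fst (\<phi> a) i \<noteq> fst (\<phi> b) i)"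
    using X_carrier by (simp add: fst_\<phi>_mult vadd_apply del: \<phi>.hom_mult)
next
  fix i j assume "i \<in> I" "j \<in> I"
  then show "fst (\<phi> (x j)) i = (i = j)"
    by (simp only: \<phi>_x) (simp add: mX_def unit_vec_def)
qed (auto simp: xx x_commute)

lemma quadratic_True: "quadratic (\<lambda>_. True)"
  using quadratic_mult_affine[OF affine_fun_const[of True] affine_fun_const[of True]] by simp

lemma C2_basis_Y: "C2_basis (G\<lparr>carrier := Y\<rparr>) I y (\<lambda>j h. snd (\<phi> h) (\<lambda>_. True, j))"
  unfolding Y_def
proof (rule C2_basis_generate)
  fix i a b assume "a \<in> generate G (y ` I)" "b \<in> generate G (y ` I)"
  then have "a \<in> N" "b \<in> N" using Y_subset_N by (auto simp: Y_def)
  then show "snd (\<phi> (a \<otimes> b)) (\<lambda>_. True, i) = (snd (\<phi> a) (\<lambda>_. True, i) \<noteq> snd (\<phi> b) (\<lambda>_. True, i))"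
    using N_carrier fst_\<phi>_N by (simp add: snd_\<phi>_mult vadd_apply del: \<phi>.hom_mult)
next
  fix i j assume "i \<in> I" "j \<in> I"
  then show "snd (\<phi> (y j)) (\<lambda>_. True, i) = (i = j)"
    by (simp only: \<phi>_y') (simp add: unit_fun_def quadratic_True)
qed (auto simp: yy y_commute)

text \<open>Write a kernel element in normal form. The first component shows that its
  \<open>X\<close>-part is trivial, then the monomial characters show the same for its
  \<open>N\<close>-part.\<close>

lemma \<phi>_inj: "inj_on \<phi> (carrier G)"
proof -
  have "h = \<one>" if h: "h \<in> carrier G" "\<phi> h = \<one>\<^bsub>model\<^esub>" for h
  proof -
    obtain a m where am: "a \<in> X" "m \<in> N" "h = a \<otimes> m" using normal_form h(1) by blast
    have "fst (\<phi> a) = vzero"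
      using h(2) am fst_\<phi>_mult[of a m] fst_\<phi>_N X_carrier N_carrier by (simp del: \<phi>.hom_mult)
    then have a: "a = \<one>"
      using C2_basis.eq_one_if_characters_vanish[OF C2_basis_X] am(1) by (simp add: vzero_apply)
    then have "\<phi> m = \<one>\<^bsub>model\<^esub>" using h am N_carrier by simp
    then have "m = \<one>"
      using C2_basis.eq_one_if_characters_vanish[OF C2_basis_N, of m] am(2) by (auto simp: vzero_apply)
    with a am show ?thesis by simp
  qed
  then show ?thesis by (simp add: \<phi>.inj_on_one_iff)
qed

section \<open>Order and abelianization\<close>

lemma order_G: "order G = 2 ^ n * 2 ^ ((1 + n + (n choose 2)) * n)"
proof -
  \<comment> \<open>The normal form is unique: the first component of \<open>\<phi>\<close> vanishes
    on \<open>N\<close> and determines the elements of \<open>X\<close>.\<close>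
  have "bij_betw (\<lambda>(a, m). a \<otimes> m) (X \<times> N) (carrier G)"
  proof (rule bij_betwI')
    fix p q assume pq: "p \<in> X \<times> N" "q \<in> X \<times> N"
    obtain a m b l where p: "p = (a, m)" "q = (b, l)" by force
    then have ab: "a \<in> X" "b \<in> X" "m \<in> N" "l \<in> N" using pq by auto
    note cl = X_carrier[OF ab(1)] X_carrier[OF ab(2)] N_carrier[OF ab(3)] N_carrier[OF ab(4)]
    have "a = b \<and> m = l" if "a \<otimes> m = b \<otimes> l"
    proof -
      from that have "fst (\<phi> (a \<otimes> m)) = fst (\<phi> (b \<otimes> l))" by simp
      then have "fst (\<phi> a) = fst (\<phi> b)" using cl ab by (simp add: fst_\<phi>_mult fst_\<phi>_N del: \<phi>.hom_mult)
      then have "\<phi> a = \<phi> b" using \<phi>_X ab by metis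
      then have "a = b" using \<phi>_inj cl by (simp add: inj_on_eq_iff)
      then show ?thesis using that cl by simp
    qed
    then show "(case p of (a, m) \<Rightarrow> a \<otimes> m) = (case q of (a, m) \<Rightarrow> a \<otimes> m) \<longleftrightarrow> p = q"
      using p by auto
  next
    fix p assume "p \<in> X \<times> N"
    then show "(case p of (a, m) \<Rightarrow> a \<otimes> m) \<in> carrier G" using X_carrier N_carrier by auto
  next
    fix h assume "h \<in> carrier G"
    then show "\<exists>p\<in>X \<times> N. h = (case p of (a, m) \<Rightarrow> a \<otimes> m)"
      by (rule normal_form) auto
  qed
  then have "order G = card (X \<times> N)" unfolding order_def by (simp add: bij_betw_same_card)
  also have "\<dots> = card X * card N" by (rule card_cartesian_product)
  finally show ?thesis
    using C2_basis.card_carrier[OF C2_basis_X] C2_basis.card_carrier[OF C2_basis_N] card_basis by simp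
qed

lemma finite_G: "finite (carrier G)"
  using order_G by (intro card_ge_0_finite) (simp add: order_def)

text \<open>The first component of \<open>\<phi>\<close> vanishes on \<open>Y\<close>, which lies in
  \<open>N\<close>, and its coordinates detect every nontrivial element of \<open>X\<close>.\<close>

lemma X_Int_Y: "X \<inter> Y = {\<one>}"
proof -
  have "a = \<one>" if "a \<in> X" "a \<in> Y" for a
    using C2_basis.eq_one_if_characters_vanish[OF C2_basis_X, of a] that fst_\<phi>_N Y_subset_N
    by (auto simp: vzero_apply)
  then show ?thesis
    using subgroup.one_closed[OF subgroup_X] subgroup.one_closed[OF subgroup_Y] by blast
qed

text \<open>Characters of the whole group, one for each generator. Translations fix the constant
  polynomial, so evaluating there is additive although the second component of \<open>\<phi>\<close>
  is twisted by \<open>shift\<close>.\<close>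

definition ab_char :: "gen \<Rightarrow> 'a \<Rightarrow> bool" where
  "ab_char k h = (case k of Xgen i \<Rightarrow> fst (\<phi> h) i | Ygen j \<Rightarrow> snd (\<phi> h) (\<lambda>_. True, j))"

lemma ab_char_mult:
  "a \<in> carrier G \<Longrightarrow> b \<in> carrier G \<Longrightarrow> ab_char k (a \<otimes> b) = (ab_char k a \<noteq> ab_char k b)"
  by (cases "\<phi> a"; cases "\<phi> b"; cases k) (simp_all add: ab_char_def vadd_apply shift_def)

lemma ab_char_one: "\<not> ab_char k \<one>"
  using ab_char_mult[of \<one> \<one> k] by simp

lemma ab_char_inv: "a \<in> carrier G \<Longrightarrow> ab_char k (inv a) = ab_char k a"
  using ab_char_mult[of a "inv a" k] ab_char_one by auto

lemma ab_char_derived: "h \<in> derived G (carrier G) \<Longrightarrow> \<not> ab_char k h"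
proof -
  have "subgroup {h \<in> carrier G. \<not> ab_char k h} G"
    by (rule subgroupI) (auto simp: ab_char_mult ab_char_inv ab_char_one intro!: exI[of _ \<one>])
  moreover have "derived_set G (carrier G) \<subseteq> {h \<in> carrier G. \<not> ab_char k h}"
    by (auto simp: ab_char_mult ab_char_inv)
  ultimately have "derived G (carrier G) \<subseteq> {h \<in> carrier G. \<not> ab_char k h}"
    unfolding derived_def by (intro generate_subgroup_incl)
  then show "h \<in> derived G (carrier G) \<Longrightarrow> \<not> ab_char k h" by blast
qed

text \<open>The cosets of the generators span the quotient. The characters \<open>ab_char\<close>
  vanish on the derived subgroup, so they descend to the quotient and are dual to these
  cosets.\<close>

lemma abelianization: "G Mod derived G (carrier G) \<cong> C2_power (2 * n)"
proof -
  let ?D = "derived G (carrier G)"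
  let ?Q = "G Mod ?D"
  interpret D: normal ?D G by (rule derived_self_is_normal)
  interpret Q: comm_group ?Q by (rule derived_quot_is_comm_group)
  interpret \<pi>: group_hom G ?Q "\<lambda>a. ?D #> a"
    by (simp add: group_hom_def group_hom_axioms_def is_group Q.is_group D.r_coset_hom_Mod)
  define g where "g k = ?D #> (case k of Xgen i \<Rightarrow> x i | Ygen j \<Rightarrow> y j)" for k
  define \<chi> where "\<chi> k A = (\<exists>a\<in>A. ab_char k a)" for k A
  have \<chi>: "\<chi> k (?D #> a) = ab_char k a" if a: "a \<in> carrier G" for k a
  proof -
    have "ab_char k b = ab_char k a" if "b \<in> ?D #> a" for b
      using that a ab_char_derived D.mem_carrier by (auto simp: r_coset_def ab_char_mult)
    then show ?thesis unfolding \<chi>_def using rcos_self[OF a D.subgroup_axioms] by blast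
  qed
  have "g ` gens n = (\<lambda>a. ?D #> a) ` (x ` I \<union> y ` I)"
    by (simp add: g_def gens_def image_Un image_image)
  moreover have "generate ?Q ((\<lambda>a. ?D #> a) ` (x ` I \<union> y ` I)) = (\<lambda>a. ?D #> a) ` carrier G"
  proof -
    have "x ` I \<union> y ` I \<subseteq> carrier G" by auto
    from \<pi>.generate_img[OF this] show ?thesis by (simp only: generated[symmetric])
  qed
  ultimately have gen: "carrier ?Q = generate ?Q (g ` gens n)"
    by (simp add: carrier_FactGroup)
  have "C2_basis ?Q (gens n) g \<chi>"
  proof unfold_locales
    show "finite (gens n)" by (simp add: gens_def)
    show "carrier ?Q = generate ?Q (g ` gens n)" by (rule gen)
    fix k assume "k \<in> gens n"
    then obtain i where i: "i \<in> I" "k = Xgen i \<or> k = Ygen i" by (auto simp: gens_def)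
    then have "(?D #> x i) \<otimes>\<^bsub>?Q\<^esub> (?D #> x i) = \<one>\<^bsub>?Q\<^esub>" "(?D #> y i) \<otimes>\<^bsub>?Q\<^esub> (?D #> y i) = \<one>\<^bsub>?Q\<^esub>"
      using \<pi>.hom_mult[of "x i" "x i"] \<pi>.hom_mult[of "y i" "y i"] \<pi>.hom_one by (simp_all add: xx yy)
    then show "g k \<otimes>\<^bsub>?Q\<^esub> g k = \<one>\<^bsub>?Q\<^esub>" using i by (auto simp: g_def)
  next
    fix k A B assume "A \<in> carrier ?Q" "B \<in> carrier ?Q"
    then obtain a b where ab: "a \<in> carrier G" "A = ?D #> a" "b \<in> carrier G" "B = ?D #> b"
      by (auto simp: carrier_FactGroup)
    then have AB: "A \<otimes>\<^bsub>?Q\<^esub> B = ?D #> (a \<otimes> b)" using \<pi>.hom_mult by simp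
    show "\<chi> k (A \<otimes>\<^bsub>?Q\<^esub> B) = (\<chi> k A \<noteq> \<chi> k B)" unfolding AB using ab by (simp add: \<chi> ab_char_mult del: \<pi>.hom_mult)
  next
    fix k l assume "k \<in> gens n" "l \<in> gens n"
    moreover have "fst (\<phi> (x j)) i = (i = j)" "\<not> snd (\<phi> (x j)) (\<lambda>_. True, i)"
      "snd (\<phi> (y j)) (\<lambda>_. True, i) = (i = j)" "\<not> fst (\<phi> (y j)) i" if "j \<in> I" for i j
      using that by (simp_all only: \<phi>_x \<phi>_y' mX_def fst_conv snd_conv)
        (auto simp: unit_vec_def vzero_apply unit_fun_def quadratic_True)
    ultimately show "\<chi> k (g l) = (k = l)"
      by (auto simp: gens_def g_def \<chi> ab_char_def)
  qed
  moreover have "card (gens n) = 2 * n"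
  proof -
    have "card (gens n) = card (Xgen ` I) + card (Ygen ` I)"
      unfolding gens_def by (rule card_Un_disjoint) auto
    then show ?thesis by (simp add: card_image inj_on_def)
  qed
  ultimately show ?thesis using C2_basis.iso_C2_power by metis
qed

lemma mixed_dihedral_XY: "mixed_dihedral n G X Y"
proof -
  have "generate G (x ` I \<union> y ` I) \<subseteq> generate G (X \<union> Y)"
    by (intro mono_generate) (auto simp: X_def Y_def intro: generate.incl)
  moreover have "generate G (X \<union> Y) \<subseteq> carrier G"
    using X_carrier Y_carrier by (intro generate_incl) auto
  ultimately have "carrier G = generate G (X \<union> Y)" using generated by simp
  then show ?thesis
    using C2_basis.iso_C2_power[OF C2_basis_X] C2_basis.iso_C2_power[OF C2_basis_Y] abelianization
      finite_G subgroup_X subgroup_Y is_group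
    by (simp add: mixed_dihedral_def)
qed

end

subsection \<open>Transvections\<close>

text \<open>Take one basis character that is true at \<open>a\<close> and one that is true at
  \<open>b\<close>. If neither is true at both elements, their sum is.\<close>

lemma (in C2_basis) common_character:
  assumes "a \<in> carrier C" "a \<noteq> \<one>" "b \<in> carrier C" "b \<noteq> \<one>"
  shows "\<exists>l. (\<forall>u\<in>carrier C. \<forall>v\<in>carrier C. l (u \<otimes> v) = (l u \<noteq> l v)) \<and> l a \<and> l b"
proof -
  obtain i j where ij: "i \<in> I" "\<chi> i a" "j \<in> I" "\<chi> j b"
    using eq_one_if_characters_vanish assms by blast
  consider "\<chi> i b" | "\<chi> j a" | "\<not> \<chi> i b" "\<not> \<chi> j a" by blast
  then show ?thesis
  proof cases
    case 1
    then show ?thesis using ij by (intro exI[of _ "\<chi> i"]) (auto simp: character)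
  next
    case 2
    then show ?thesis using ij by (intro exI[of _ "\<chi> j"]) (auto simp: character)
  next
    case 3
    then show ?thesis
      using ij by (intro exI[of _ "\<lambda>u. \<chi> i u \<noteq> \<chi> j u"]) (auto simp: character)
  qed
qed

text \<open>In additive terms \<open>h\<close> maps \<open>u\<close> in \<open>U\<close> to
  \<open>u + l(u)(a + b)\<close> and fixes \<open>V\<close>. Since \<open>l\<close> vanishes on
  \<open>a \<otimes> b\<close>, that element is fixed; hence \<open>h\<close> is an involution, and
  it exchanges \<open>a\<close> and \<open>b\<close>.\<close>

lemma (in group) transvection_automorphism:
  assumes U: "subgroup U G" "U = generate G S"
    and V: "subgroup V G" "V = generate G T"
    and gen: "carrier G = generate G (S \<union> T)"
    and comm: "\<And>u v. u \<in> U \<Longrightarrow> v \<in> U \<Longrightarrow> u \<otimes> v = v \<otimes> u"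
    and square: "\<And>u. u \<in> U \<Longrightarrow> u \<otimes> u = \<one>"
    and char: "\<And>u v. u \<in> U \<Longrightarrow> v \<in> U \<Longrightarrow> l (u \<otimes> v) = (l u \<noteq> l v)"
    and ab: "a \<in> U" "l a" "b \<in> U" "l b"
    and h: "h \<in> hom G G" "\<And>t. t \<in> T \<Longrightarrow> h t = t"
      "\<And>s. s \<in> S \<Longrightarrow> h s = s \<otimes> (if l s then a \<otimes> b else \<one>)"
  shows "bij_betw h (carrier G) (carrier G)" "h ` U = U" "h ` V = V" "h a = b"
proof -
  interpret h: group_hom G G h
    using h(1) by (simp add: group_hom_def group_hom_axioms_def is_group)
  interpret U: subgroup U G by fact
  interpret V: subgroup V G by fact
  let ?w = "a \<otimes> b"
  let ?e = "\<lambda>u. if l u then ?w else \<one>"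
  have cl: "u \<in> carrier G" if "u \<in> U" for u using that by simp
  have w: "?w \<in> U" using ab by simp
  have l1: "\<not> l \<one>" using char[of \<one> \<one>] by simp
  have lw: "\<not> l ?w" using char[of a b] ab by simp
  \<comment> \<open>The formula is given on the generators \<open>S\<close> and extends to
    \<open>U\<close> because \<open>l\<close> is additive.\<close>
  have hU: "h u = u \<otimes> ?e u" if "u \<in> U" for u
    using that unfolding U(2)
  proof induction
    case one
    then show ?case using l1 by simp
  next
    case (incl s)
    then show ?case by (rule h)
  next
    case (inv s)
    then have "s \<in> U" unfolding U(2) by (rule generate.incl)
    then have "inv s = s" using square cl by (simp add: inv_equality)
    then show ?case using h(3)[OF inv] by simp
  next
    case (eng u v)
    then have uv: "u \<in> U" "v \<in> U" by (simp_all add: U(2))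
    have e: "?e u \<in> U" "?e v \<in> U" using w by simp_all
    have "h (u \<otimes> v) = u \<otimes> ?e u \<otimes> (v \<otimes> ?e v)"
      using eng uv cl by simp
    also have "\<dots> = u \<otimes> (?e u \<otimes> v) \<otimes> ?e v"
      using uv e cl by (simp only: m_assoc m_closed)
    also have "\<dots> = u \<otimes> v \<otimes> (?e u \<otimes> ?e v)"
      unfolding comm[OF e(1) uv(2)] using uv e cl by (simp only: m_assoc m_closed)
    also have "?e u \<otimes> ?e v = ?e (u \<otimes> v)"
      using square[OF w] cl[OF w] char[OF uv] by simp
    finally show ?case .
  qed
  have hV: "h v = v" if "v \<in> V" for v
    using that unfolding V(2)
  proof induction
    case (inv t)
    then have "t \<in> V" unfolding V(2) by (rule generate.incl)
    then show ?case using h(2)[OF inv] by simp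
  next
    case (eng u v)
    then have "u \<in> V" "v \<in> V" by (simp_all add: V(2))
    then show ?case using eng by simp
  qed (use h in auto)
  have hw: "h ?w = ?w" using hU[OF w] lw cl[OF w] by simp
  have hh: "h (h u) = u" if "u \<in> carrier G" for u
  proof -
    have "subgroup {u \<in> carrier G. h (h u) = u} G"
      by (rule subgroupI) (auto intro!: exI[of _ \<one>])
    moreover have "h (h s) = s" if "s \<in> S" for s
    proof -
      have s: "s \<in> U" using that unfolding U(2) by (rule generate.incl)
      have "h (h s) = h s \<otimes> h (?e s)" using hU[OF s] cl s w by simp
      also have "\<dots> = s \<otimes> (?e s \<otimes> ?e s)" using hU[OF s] hw cl[OF s] cl[OF w] by (simp add: m_assoc)
      also have "\<dots> = s" using square[OF w] cl[OF s] by simp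
      finally show ?thesis .
    qed
    moreover have "h (h t) = t" if "t \<in> T" for t using h(2) that by simp
    moreover have "S \<union> T \<subseteq> carrier G"
      unfolding gen by (rule subsetI) (rule generate.incl)
    ultimately have "generate G (S \<union> T) \<subseteq> {u \<in> carrier G. h (h u) = u}"
      by (intro generate_subgroup_incl) auto
    then have "carrier G \<subseteq> {u \<in> carrier G. h (h u) = u}" unfolding gen[symmetric] .
    then show ?thesis using that by auto
  qed
  show "bij_betw h (carrier G) (carrier G)"
    by (rule bij_betwI[where g = h]) (auto simp: hh)
  have hUU: "h u \<in> U" if "u \<in> U" for u using hU[OF that] that w by simp
  show "h ` U = U"
  proof
    show "U \<subseteq> h ` U"
    proof
      fix u assume u: "u \<in> U"
      show "u \<in> h ` U" by (rule image_eqI[of u h "h u"]) (simp_all only: hh[OF cl[OF u]] hUU[OF u])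
    qed
  qed (use hUU in blast)
  show "h ` V = V" using hV by simp
  have "h a = a \<otimes> a \<otimes> b" using hU[OF ab(1)] ab cl by (simp add: m_assoc)
  then show "h a = b" using square[OF ab(1)] cl[OF ab(3)] by simp
qed

context Hn_presented
begin

text \<open>The model satisfies the relations for all translations and all \<open>mY w\<close>, and
  \<open>\<phi>\<close> reflects them. Hence \<open>lift\<close> accepts any images of the
  generators chosen inside \<open>X\<close> and \<open>Y\<close>.\<close>

lemma relations_XY: "Hn_relations G X Y"
proof (rule Hn_relations_inj_hom[OF is_group group_model \<phi>_hom \<phi>_inj])
  have "\<phi> ` X \<subseteq> range mX" "\<phi> ` Y \<subseteq> range mY"
    using \<phi>_X \<phi>_Y by blast+
  then show "Hn_relations model (\<phi> ` X) (\<phi> ` Y)"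
    by (rule Hn_relations_mono[OF Hn_relations_model])
qed (use X_carrier Y_carrier in auto)

lemma C2_facts:
  "u \<in> X \<Longrightarrow> v \<in> X \<Longrightarrow> u \<otimes> v = v \<otimes> u" "u \<in> X \<Longrightarrow> u \<otimes> u = \<one>"
  "u \<in> Y \<Longrightarrow> v \<in> Y \<Longrightarrow> u \<otimes> v = v \<otimes> u" "u \<in> Y \<Longrightarrow> u \<otimes> u = \<one>"
proof -
  interpret Xb: C2_basis "G\<lparr>carrier := X\<rparr>" I x "\<lambda>i h. fst (\<phi> h) i" by (rule C2_basis_X)
  interpret Yb: C2_basis "G\<lparr>carrier := Y\<rparr>" I y "\<lambda>j h. snd (\<phi> h) (\<lambda>_. True, j)" by (rule C2_basis_Y)
  show "u \<in> X \<Longrightarrow> v \<in> X \<Longrightarrow> u \<otimes> v = v \<otimes> u" "u \<in> X \<Longrightarrow> u \<otimes> u = \<one>"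
    using Xb.m_comm[of u v] Xb.square_eq_one[of u] by auto
  show "u \<in> Y \<Longrightarrow> v \<in> Y \<Longrightarrow> u \<otimes> v = v \<otimes> u" "u \<in> Y \<Longrightarrow> u \<otimes> u = \<one>"
    using Yb.m_comm[of u v] Yb.square_eq_one[of u] by auto
qed

lemma x_in_X: "i \<in> I \<Longrightarrow> x i \<in> X" and y_in_Y: "i \<in> I \<Longrightarrow> y i \<in> Y"
  by (auto simp: X_def Y_def intro: generate.incl)

text \<open>A character true at both \<open>a\<close> and \<open>b\<close> defines the transvection
  along \<open>a \<otimes> b\<close>. It keeps each \<open>y j\<close> inside \<open>Y\<close>, so
  \<open>lift\<close> extends it to the group with every \<open>x i\<close> fixed.\<close>

lemma automorphism_Y:
  assumes "a \<in> Y" "a \<noteq> \<one>" "b \<in> Y" "b \<noteq> \<one>"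
  shows "\<exists>h\<in>hom G G. bij_betw h (carrier G) (carrier G) \<and> h ` X = X \<and> h ` Y = Y \<and> h a = b"
proof -
  interpret C2: C2_basis "G\<lparr>carrier := Y\<rparr>" I y "\<lambda>j h. snd (\<phi> h) (\<lambda>_. True, j)" by (rule C2_basis_Y)
  obtain l where l: "\<And>u v. u \<in> Y \<Longrightarrow> v \<in> Y \<Longrightarrow> l (u \<otimes> v) = (l u \<noteq> l v)" "l a" "l b"
    using C2.common_character[of a b] assms by auto
  interpret Y: subgroup Y G by (rule subgroup_Y)
  let ?y = "\<lambda>j. y j \<otimes> (if l (y j) then a \<otimes> b else \<one>)"
  have "?y ` I \<subseteq> Y" using y_in_Y assms by auto
  then have "Hn_relations G (x ` I) (?y ` I)"
    using x_in_X by (intro Hn_relations_mono[OF relations_XY]) auto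
  moreover have "?y ` I \<subseteq> carrier G" using \<open>?y ` I \<subseteq> Y\<close> Y_carrier by blast
  ultimately obtain h where h: "h \<in> hom G G" "\<And>i. i \<in> I \<Longrightarrow> h (x i) = x i" "\<And>i. i \<in> I \<Longrightarrow> h (y i) = ?y i"
    using lift[of x ?y] x_in_X X_carrier by (auto simp: image_subset_iff)
  have "carrier G = generate G (y ` I \<union> x ` I)" using generated by (simp add: Un_commute)
  note * = transvection_automorphism[OF subgroup_Y Y_def subgroup_X X_def this C2_facts(3,4) l(1)
      assms(1) l(2) assms(3) l(3) h(1)]
  show ?thesis using h by (intro bexI[of _ h] conjI *) auto
qed

lemma automorphism_X:
  assumes "a \<in> X" "a \<noteq> \<one>" "b \<in> X" "b \<noteq> \<one>"
  shows "\<exists>h\<in>hom G G. bij_betw h (carrier G) (carrier G) \<and> h ` X = X \<and> h ` Y = Y \<and> h a = b"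
proof -
  interpret C2: C2_basis "G\<lparr>carrier := X\<rparr>" I x "\<lambda>i h. fst (\<phi> h) i" by (rule C2_basis_X)
  obtain l where l: "\<And>u v. u \<in> X \<Longrightarrow> v \<in> X \<Longrightarrow> l (u \<otimes> v) = (l u \<noteq> l v)" "l a" "l b"
    using C2.common_character[of a b] assms by auto
  interpret X: subgroup X G by (rule subgroup_X)
  let ?x = "\<lambda>j. x j \<otimes> (if l (x j) then a \<otimes> b else \<one>)"
  have "?x ` I \<subseteq> X" using x_in_X assms by auto
  then have "Hn_relations G (?x ` I) (y ` I)"
    using y_in_Y by (intro Hn_relations_mono[OF relations_XY]) auto
  moreover have "?x ` I \<subseteq> carrier G" using \<open>?x ` I \<subseteq> X\<close> X_carrier by blast
  ultimately obtain h where h: "h \<in> hom G G" "\<And>i. i \<in> I \<Longrightarrow> h (x i) = ?x i" "\<And>i. i \<in> I \<Longrightarrow> h (y i) = y i"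
    using lift[of ?x y] y_in_Y Y_carrier by (auto simp: image_subset_iff)
  note * = transvection_automorphism[OF subgroup_X X_def subgroup_Y Y_def generated C2_facts(1,2) l(1)
      assms(1) l(2) assms(3) l(3) h(1)]
  show ?thesis using h by (intro bexI[of _ h] conjI *) auto
qed

end

subsection \<open>Coset graphs\<close>

lemma graph_autsD:
  assumes "f \<in> graph_auts \<Gamma>"
  shows "u \<in> verts \<Gamma> \<Longrightarrow> f u \<in> verts \<Gamma>"
    and "u \<in> verts \<Gamma> \<Longrightarrow> v \<in> verts \<Gamma> \<Longrightarrow> f u = f v \<longleftrightarrow> u = v"
    and "u \<in> verts \<Gamma> \<Longrightarrow> v \<in> verts \<Gamma> \<Longrightarrow> {f u, f v} \<in> edges \<Gamma> \<longleftrightarrow> {u, v} \<in> edges \<Gamma>"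
  using assms by (auto simp: graph_auts_def Bij_def bij_betw_def inj_on_def)

lemma (in group) coset_eq_iff:
  assumes "subgroup U G" "g \<in> carrier G" "h \<in> carrier G"
  shows "U #> g = U #> h \<longleftrightarrow> (\<exists>u\<in>U. g = u \<otimes> h)"
proof
  assume "U #> g = U #> h"
  then have "g \<in> U #> h" using rcos_self[OF assms(2,1)] by simp
  then show "\<exists>u\<in>U. g = u \<otimes> h" by (auto simp: r_coset_def)
next
  assume "\<exists>u\<in>U. g = u \<otimes> h"
  then have "g \<in> U #> h" by (auto simp: r_coset_def)
  then show "U #> g = U #> h" using repr_independence[OF _ assms(3,1)] by simp
qed

text \<open>Given the trivial intersection, \<open>X_neq_Y\<close> excludes only the case that both
  subgroups are trivial, in which the two kinds of vertices would coincide.\<close>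

locale coset_pair = group G for G :: "'a monoid" (structure) +
  fixes X Y :: "'a set"
  assumes subgroup_X: "subgroup X G" and subgroup_Y: "subgroup Y G"
    and X_Int_Y: "X \<inter> Y = {\<one>}" and X_neq_Y: "X \<noteq> Y"
begin

abbreviation "\<Gamma> \<equiv> coset_graph G X Y"

sublocale X: subgroup X G by (rule subgroup_X)
sublocale Y: subgroup Y G by (rule subgroup_Y)

lemma swapped: "coset_pair G Y X"
  using subgroup_X subgroup_Y X_Int_Y X_neq_Y by unfold_locales auto

lemma coset_graph_swap: "coset_graph G Y X = \<Gamma>"
proof -
  have "{{Y #> h, X #> g} | h g. h \<in> carrier G \<and> g \<in> carrier G \<and> (Y #> h) \<inter> (X #> g) \<noteq> {}}
      = {{X #> h, Y #> g} | h g. h \<in> carrier G \<and> g \<in> carrier G \<and> (X #> h) \<inter> (Y #> g) \<noteq> {}}"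
    by (auto simp: insert_commute)
  then show ?thesis by (auto simp: coset_graph_def)
qed

lemma vertsI: "h \<in> carrier G \<Longrightarrow> X #> h \<in> verts \<Gamma>" "h \<in> carrier G \<Longrightarrow> Y #> h \<in> verts \<Gamma>"
  by (auto simp: coset_graph_def)

lemma verts_cases:
  assumes "u \<in> verts \<Gamma>"
  obtains (X) h where "h \<in> carrier G" "u = X #> h" | (Y) h where "h \<in> carrier G" "u = Y #> h"
  using assms by (auto simp: coset_graph_def)

lemma X_coset_neq_Y_coset:
  assumes "h \<in> carrier G" "g \<in> carrier G"
  shows "X #> h \<noteq> Y #> g"
proof
  assume eq: "X #> h = Y #> g"
  then have "h \<in> Y #> g" using rcos_self[OF assms(1) subgroup_X] by simp
  then have "Y #> g = Y #> h" using repr_independence[OF _ assms(2) subgroup_Y] by simp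
  with eq have eq: "X #> h = Y #> h" by simp
  have "u \<in> X \<longleftrightarrow> u \<in> Y" if "u \<in> carrier G" for u
  proof -
    have "u \<in> V \<longleftrightarrow> u \<otimes> h \<in> V #> h" if "V \<subseteq> carrier G" for V
      using that assms(1) \<open>u \<in> carrier G\<close> by (auto simp: r_coset_def subset_iff)
    then show ?thesis using eq X.subset Y.subset by metis
  qed
  then show False using X_neq_Y X.subset Y.subset by blast
qed

text \<open>A common element \<open>k\<close> of two cosets represents both. So the edges are the
  right translates of the single edge \<open>{X, Y}\<close>.\<close>

lemma edges_iff: "e \<in> edges \<Gamma> \<longleftrightarrow> (\<exists>k\<in>carrier G. e = {X #> k, Y #> k})"
proof
  assume "e \<in> edges \<Gamma>"
  then obtain h g where hg: "h \<in> carrier G" "g \<in> carrier G" "e = {X #> h, Y #> g}"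
    "(X #> h) \<inter> (Y #> g) \<noteq> {}"
    by (auto simp: coset_graph_def)
  then obtain k where k: "k \<in> X #> h" "k \<in> Y #> g" by blast
  then have "X #> k = X #> h" "Y #> k = Y #> g"
    using repr_independence[OF _ hg(1) subgroup_X] repr_independence[OF _ hg(2) subgroup_Y] by auto
  moreover have "k \<in> carrier G" using k(1) hg(1) r_coset_subset_G[OF X.subset] by blast
  ultimately show "\<exists>k\<in>carrier G. e = {X #> k, Y #> k}" using hg(3) by auto
next
  assume "\<exists>k\<in>carrier G. e = {X #> k, Y #> k}"
  then obtain k where k: "k \<in> carrier G" "e = {X #> k, Y #> k}" by blast
  then have "(X #> k) \<inter> (Y #> k) \<noteq> {}"
    using rcos_self[OF k(1) subgroup_X] rcos_self[OF k(1) subgroup_Y] by blast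
  then show "e \<in> edges \<Gamma>" using k by (auto simp: coset_graph_def)
qed

lemma edge_at_X:
  assumes "h \<in> carrier G"
  shows "{X #> h, C} \<in> edges \<Gamma> \<longleftrightarrow> (\<exists>x\<in>X. C = Y #> (x \<otimes> h))"
proof
  assume "{X #> h, C} \<in> edges \<Gamma>"
  then obtain k where k: "k \<in> carrier G" "{X #> h, C} = {X #> k, Y #> k}"
    by (auto simp: edges_iff)
  then have "X #> h = X #> k" "C = Y #> k"
    using X_coset_neq_Y_coset[OF assms k(1)] by (auto simp: doubleton_eq_iff)
  moreover then obtain x where "x \<in> X" "k = x \<otimes> h"
    using coset_eq_iff[OF subgroup_X k(1) assms] by auto
  ultimately show "\<exists>x\<in>X. C = Y #> (x \<otimes> h)" by blast
next
  assume "\<exists>x\<in>X. C = Y #> (x \<otimes> h)"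
  then obtain x where x: "x \<in> X" "C = Y #> (x \<otimes> h)" by blast
  then have "X #> h = X #> (x \<otimes> h)"
    using coset_eq_iff[OF subgroup_X, of "x \<otimes> h" h] assms by auto
  then show "{X #> h, C} \<in> edges \<Gamma>" using x assms by (auto simp: edges_iff)
qed

lemma edge_at_Y:
  assumes "h \<in> carrier G"
  shows "{Y #> h, C} \<in> edges \<Gamma> \<longleftrightarrow> (\<exists>y\<in>Y. C = X #> (y \<otimes> h))"
  using coset_pair.edge_at_X[OF swapped assms] by (simp add: coset_graph_swap)

lemma simple: "simple_graph \<Gamma>"
  unfolding simple_graph_def
proof
  fix e assume "e \<in> edges \<Gamma>"
  then obtain k where k: "k \<in> carrier G" "e = {X #> k, Y #> k}" by (auto simp: edges_iff)
  then show "\<exists>u\<in>verts \<Gamma>. \<exists>v\<in>verts \<Gamma>. u \<noteq> v \<and> e = {u, v}"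
    using vertsI[OF k(1)] X_coset_neq_Y_coset[OF k(1) k(1)] by blast
qed

lemma edges_verts: "{u, v} \<in> edges \<Gamma> \<Longrightarrow> u \<in> verts \<Gamma> \<and> v \<in> verts \<Gamma>"
proof -
  assume "{u, v} \<in> edges \<Gamma>"
  then obtain k where k: "k \<in> carrier G" "{u, v} = {X #> k, Y #> k}" by (auto simp: edges_iff)
  then show ?thesis using vertsI[OF k(1)] by (auto simp: doubleton_eq_iff)
qed

text \<open>The neighbours of \<open>X #> h\<close> are the cosets
  \<open>Y #> (x \<otimes> h)\<close>; if \<open>a\<close> and \<open>b\<close> in \<open>X\<close>
  give the same one, \<open>a \<otimes> inv b\<close> lies in \<open>X \<inter> Y\<close>.\<close>

lemma valency_X:
  assumes "h \<in> carrier G"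
  shows "valency \<Gamma> (X #> h) = card X"
proof -
  have "{v \<in> verts \<Gamma>. {X #> h, v} \<in> edges \<Gamma>} = (\<lambda>x. Y #> (x \<otimes> h)) ` X"
    using assms by (auto simp: edge_at_X[OF assms] intro: vertsI)
  moreover have "inj_on (\<lambda>x. Y #> (x \<otimes> h)) X"
  proof (rule inj_onI)
    fix a b assume ab: "a \<in> X" "b \<in> X" "Y #> (a \<otimes> h) = Y #> (b \<otimes> h)"
    then obtain y where y: "y \<in> Y" "a \<otimes> h = y \<otimes> (b \<otimes> h)"
      using coset_eq_iff[OF subgroup_Y, of "a \<otimes> h" "b \<otimes> h"] assms by auto
    then have "a \<otimes> h = y \<otimes> b \<otimes> h" using ab assms by (simp add: m_assoc)
    then have "a = y \<otimes> b" using ab y assms by (subst (asm) right_cancel) auto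
    then have "y = a \<otimes> inv b" using ab y by (simp add: m_assoc)
    then have "y \<in> X \<inter> Y" using ab y by simp
    then have "y = \<one>" using X_Int_Y by simp
    then show "a = b" using \<open>a = y \<otimes> b\<close> ab by simp
  qed
  ultimately show ?thesis unfolding valency_def by (simp add: card_image)
qed

lemma has_valency_card:
  assumes "card X = m" "card Y = m"
  shows "has_valency \<Gamma> m"
  unfolding has_valency_def
proof
  fix u assume "u \<in> verts \<Gamma>"
  then show "valency \<Gamma> u = m"
  proof (cases rule: verts_cases)
    case (X h)
    then show ?thesis using valency_X assms by simp
  next
    case (Y h)
    then show ?thesis using coset_pair.valency_X[OF swapped Y(1)] assms by (simp add: coset_graph_swap)
  qed
qed

text \<open>Lagrange's theorem for each kind of coset; the product form avoids division.\<close>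

lemma card_verts:
  assumes "finite (carrier G)" "card X = m" "card Y = m"
  shows "card (verts \<Gamma>) * m = 2 * order G"
proof -
  have "verts \<Gamma> = rcosets X \<union> rcosets Y"
    by (auto simp: coset_graph_def RCOSETS_def)
  moreover have "rcosets X \<inter> rcosets Y = {}"
    using X_coset_neq_Y_coset by (auto simp: RCOSETS_def)
  moreover have "finite (rcosets X)" "finite (rcosets Y)"
    using assms(1) by (auto simp: RCOSETS_def)
  ultimately have "card (verts \<Gamma>) = card (rcosets X) + card (rcosets Y)"
    by (simp add: card_Un_disjoint)
  then show ?thesis
    using lagrange[OF subgroup_X] lagrange[OF subgroup_Y] assms by (simp add: algebra_simps)
qed

text \<open>A common frame for right multiplications and for automorphisms preserving
  \<open>X\<close> and \<open>Y\<close>, closed under composition so that the two can be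
  combined.\<close>

definition coset_map :: "('a \<Rightarrow> 'a) \<Rightarrow> bool" where
  "coset_map \<theta> \<longleftrightarrow> bij_betw \<theta> (carrier G) (carrier G) \<and>
    (\<forall>h\<in>carrier G. \<theta> ` (X #> h) = X #> \<theta> h \<and> \<theta> ` (Y #> h) = Y #> \<theta> h)"

lemma coset_map_comp:
  assumes \<theta>: "coset_map \<theta>" and \<eta>: "coset_map \<eta>"
  shows "coset_map (\<lambda>g. \<theta> (\<eta> g))"
  unfolding coset_map_def
proof (intro conjI ballI)
  show "bij_betw (\<lambda>g. \<theta> (\<eta> g)) (carrier G) (carrier G)"
    using bij_betw_trans[of \<eta> "carrier G" "carrier G" \<theta> "carrier G"] \<theta> \<eta>
    by (simp add: coset_map_def comp_def)
  fix h assume h: "h \<in> carrier G"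
  then have \<eta>h: "\<eta> h \<in> carrier G" using \<eta> by (auto simp: coset_map_def bij_betw_def)
  have comp: "(\<lambda>g. \<theta> (\<eta> g)) ` A = \<theta> ` (\<eta> ` A)" for A by (simp add: image_image)
  show "(\<lambda>g. \<theta> (\<eta> g)) ` (X #> h) = X #> \<theta> (\<eta> h)" "(\<lambda>g. \<theta> (\<eta> g)) ` (Y #> h) = Y #> \<theta> (\<eta> h)"
    unfolding comp using h \<eta>h \<theta> \<eta> by (simp_all add: coset_map_def)
qed

lemma coset_map_right_mult:
  assumes "k \<in> carrier G"
  shows "coset_map (\<lambda>g. g \<otimes> k)"
proof -
  have "bij_betw (\<lambda>g. g \<otimes> k) (carrier G) (carrier G)"
    by (rule bij_betwI[where g = "\<lambda>g. g \<otimes> inv k"]) (use assms in \<open>auto simp: m_assoc\<close>)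
  moreover have "(\<lambda>g. g \<otimes> k) ` (U #> h) = U #> (h \<otimes> k)" if "U \<subseteq> carrier G" "h \<in> carrier G" for U h
    using that assms by (force simp: r_coset_def m_assoc subset_iff)
  ultimately show ?thesis unfolding coset_map_def using X.subset Y.subset by blast
qed

lemma coset_map_automorphism:
  assumes "\<sigma> \<in> hom G G" "bij_betw \<sigma> (carrier G) (carrier G)" "\<sigma> ` X = X" "\<sigma> ` Y = Y"
  shows "coset_map \<sigma>"
proof -
  have "\<sigma> ` (U #> h) = \<sigma> ` U #> \<sigma> h" if "U \<subseteq> carrier G" "h \<in> carrier G" for U h
    using that hom_mult[OF assms(1)] by (force simp: r_coset_def subset_iff)
  then show ?thesis unfolding coset_map_def using assms X.subset Y.subset by simp
qed

text \<open>The edge \<open>{X #> k, Y #> k}\<close> goes to the edge belonging to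
  \<open>\<theta> k\<close>. The map is restricted because \<open>Bij\<close> consists of
  extensional functions.\<close>

lemma coset_map_graph_aut:
  assumes "coset_map \<theta>"
  shows "restrict ((`) \<theta>) (verts \<Gamma>) \<in> graph_auts \<Gamma>"
proof -
  have bij: "bij_betw \<theta> (carrier G) (carrier G)"
    and img: "\<And>h. h \<in> carrier G \<Longrightarrow> \<theta> ` (X #> h) = X #> \<theta> h"
      "\<And>h. h \<in> carrier G \<Longrightarrow> \<theta> ` (Y #> h) = Y #> \<theta> h"
    using assms by (auto simp: coset_map_def)
  have cl: "\<theta> h \<in> carrier G" if "h \<in> carrier G" for h using bij that by (auto simp: bij_betw_def)
  have onto: "\<exists>k\<in>carrier G. \<theta> k = h" if "h \<in> carrier G" for h
  proof -
    have "h \<in> \<theta> ` carrier G" using that bij_betw_imp_surj_on[OF bij] by simp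
    then show ?thesis by auto
  qed
  have sub: "u \<subseteq> carrier G" if "u \<in> verts \<Gamma>" for u
    using that by (cases rule: verts_cases) (simp_all add: r_coset_subset_G X.subset Y.subset)
  have inj: "\<theta> ` u = \<theta> ` v \<longleftrightarrow> u = v" if "u \<in> verts \<Gamma>" "v \<in> verts \<Gamma>" for u v
    using inj_on_image_eq_iff[of \<theta> "carrier G" u v] bij sub that by (auto simp: bij_betw_def)
  have into: "\<theta> ` u \<in> verts \<Gamma>" if "u \<in> verts \<Gamma>" for u
    using that by (cases rule: verts_cases) (auto simp: img intro: vertsI cl)
  have "v \<in> (`) \<theta> ` verts \<Gamma>" if "v \<in> verts \<Gamma>" for v
    using that
  proof (cases rule: verts_cases)
    case (X h)
    then show ?thesis using onto[of h] img vertsI by (metis image_eqI)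
  next
    case (Y h)
    then show ?thesis using onto[of h] img vertsI by (metis image_eqI)
  qed
  then have "bij_betw ((`) \<theta>) (verts \<Gamma>) (verts \<Gamma>)"
    using into inj by (auto simp: bij_betw_def inj_on_def)
  moreover have "{u, v} \<in> edges \<Gamma> \<longleftrightarrow> {\<theta> ` u, \<theta> ` v} \<in> edges \<Gamma>" if uv: "u \<in> verts \<Gamma>" "v \<in> verts \<Gamma>" for u v
  proof
    assume "{u, v} \<in> edges \<Gamma>"
    then obtain k where k: "k \<in> carrier G" "{u, v} = {X #> k, Y #> k}" by (auto simp: edges_iff)
    have "{\<theta> ` u, \<theta> ` v} = (`) \<theta> ` {u, v}" by simp
    also have "\<dots> = {X #> \<theta> k, Y #> \<theta> k}"
      unfolding k(2) using img[OF k(1)] by simp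
    finally show "{\<theta> ` u, \<theta> ` v} \<in> edges \<Gamma>" using k cl by (auto simp: edges_iff)
  next
    assume "{\<theta> ` u, \<theta> ` v} \<in> edges \<Gamma>"
    then obtain k' where k': "k' \<in> carrier G" "{\<theta> ` u, \<theta> ` v} = {X #> k', Y #> k'}"
      by (auto simp: edges_iff)
    obtain k where k: "k \<in> carrier G" "\<theta> k = k'" using onto k'(1) by blast
    have "{\<theta> ` u, \<theta> ` v} = {\<theta> ` (X #> k), \<theta> ` (Y #> k)}" using k' k img by simp
    then have "{u, v} = {X #> k, Y #> k}"
      using inj uv vertsI[OF k(1)] by (simp add: doubleton_eq_iff)
    then show "{u, v} \<in> edges \<Gamma>" using k by (auto simp: edges_iff)
  qed
  ultimately show ?thesis
    by (auto simp: graph_auts_def Bij_def cong: bij_betw_cong)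
qed

lemma edge_transitive_coset_graph: "edge_transitive \<Gamma>"
  unfolding edge_transitive_def
proof (intro ballI)
  fix e e' assume "e \<in> edges \<Gamma>" "e' \<in> edges \<Gamma>"
  then obtain k k' where k: "k \<in> carrier G" "e = {X #> k, Y #> k}" "k' \<in> carrier G" "e' = {X #> k', Y #> k'}"
    by (auto simp: edges_iff)
  let ?\<theta> = "\<lambda>g. g \<otimes> (inv k \<otimes> k')"
  have \<theta>: "coset_map ?\<theta>" using k by (intro coset_map_right_mult) simp
  have "?\<theta> k = k'" using k by (simp flip: m_assoc)
  then have "?\<theta> ` (X #> k) = X #> k'" "?\<theta> ` (Y #> k) = Y #> k'"
    using \<theta> k unfolding coset_map_def by metis+
  then have "restrict ((`) ?\<theta>) (verts \<Gamma>) ` e = e'"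
    using k vertsI by simp
  then show "\<exists>f\<in>graph_auts \<Gamma>. f ` e = e'" using coset_map_graph_aut[OF \<theta>] by blast
qed

text \<open>Replacing \<open>h\<close> by \<open>k = x \<otimes> h\<close> makes one element
  represent the first two vertices. The arc is then the right translate by \<open>k\<close> of an
  arc starting with \<open>X\<close> and \<open>Y\<close>.\<close>

lemma two_arcs_at_X:
  assumes "h \<in> carrier G" "(X #> h, v, w) \<in> two_arcs \<Gamma>"
  shows "\<exists>k\<in>carrier G. \<exists>y\<in>Y - {\<one>}. X #> h = X #> k \<and> v = Y #> k \<and> w = X #> (y \<otimes> k)"
proof -
  have e: "{X #> h, v} \<in> edges \<Gamma>" "{v, w} \<in> edges \<Gamma>" "X #> h \<noteq> w"
    using assms(2) by (auto simp: two_arcs_def)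
  obtain x where x: "x \<in> X" "v = Y #> (x \<otimes> h)" using e(1) edge_at_X[OF assms(1)] by blast
  then obtain y where y: "y \<in> Y" "w = X #> (y \<otimes> (x \<otimes> h))"
    using e(2) edge_at_Y[of "x \<otimes> h"] assms(1) by auto
  have h: "X #> h = X #> (x \<otimes> h)"
    using coset_eq_iff[OF subgroup_X, of "x \<otimes> h" h] assms x by auto
  have xh: "x \<otimes> h \<in> carrier G" using x assms(1) by simp
  have "y \<noteq> \<one>"
  proof
    assume "y = \<one>"
    then have "w = X #> (x \<otimes> h)" using y(2) xh by simp
    with h e(3) show False by metis
  qed
  then show ?thesis using x(2) y h xh by blast
qed

lemma two_arc_transitive_at_X:
  assumes aut: "\<And>a b. a \<in> Y - {\<one>} \<Longrightarrow> b \<in> Y - {\<one>} \<Longrightarrow>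
      \<exists>\<sigma>\<in>hom G G. bij_betw \<sigma> (carrier G) (carrier G) \<and> \<sigma> ` X = X \<and> \<sigma> ` Y = Y \<and> \<sigma> a = b"
    and h: "h \<in> carrier G" and arcs: "(X #> h, v, w) \<in> two_arcs \<Gamma>" "(X #> h, v', w') \<in> two_arcs \<Gamma>"
  shows "\<exists>f\<in>graph_auts \<Gamma>. f (X #> h) = X #> h \<and> f v = v' \<and> f w = w'"
proof -
  obtain k a where k: "k \<in> carrier G" "a \<in> Y - {\<one>}" "X #> h = X #> k" "v = Y #> k" "w = X #> (a \<otimes> k)"
    using two_arcs_at_X[OF h arcs(1)] by blast
  obtain k' b where k': "k' \<in> carrier G" "b \<in> Y - {\<one>}" "X #> h = X #> k'" "v' = Y #> k'" "w' = X #> (b \<otimes> k')"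
    using two_arcs_at_X[OF h arcs(2)] by blast
  obtain \<sigma> where \<sigma>: "\<sigma> \<in> hom G G" "bij_betw \<sigma> (carrier G) (carrier G)" "\<sigma> ` X = X" "\<sigma> ` Y = Y" "\<sigma> a = b"
    using aut[OF k(2) k'(2)] by blast
  \<comment> \<open>Translate the first arc back to the base edge, apply \<open>\<sigma>\<close> to
    adjust the third vertex, and translate forward to the second arc.\<close>
  let ?\<theta> = "\<lambda>g. \<sigma> (g \<otimes> inv k) \<otimes> k'"
  have \<theta>: "coset_map ?\<theta>"
    using coset_map_comp[OF coset_map_right_mult[OF k'(1)]
        coset_map_comp[OF coset_map_automorphism[OF \<sigma>(1-4)] coset_map_right_mult[of "inv k"]]] k(1)
    by simp
  have a: "a \<in> carrier G" using k(2) by simp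
  have "?\<theta> k = k'" using k(1) k'(1) hom_one[OF \<sigma>(1)] is_group by simp
  moreover have "?\<theta> (a \<otimes> k) = b \<otimes> k'" using k(1) a \<sigma>(5) by (simp add: m_assoc)
  moreover have "?\<theta> ` (X #> k) = X #> ?\<theta> k" "?\<theta> ` (Y #> k) = Y #> ?\<theta> k"
    "?\<theta> ` (X #> (a \<otimes> k)) = X #> ?\<theta> (a \<otimes> k)"
    using \<theta> k(1) a unfolding coset_map_def by blast+
  ultimately have img: "?\<theta> ` (X #> k) = X #> k'" "?\<theta> ` (Y #> k) = Y #> k'"
    "?\<theta> ` (X #> (a \<otimes> k)) = X #> (b \<otimes> k')"
    by simp_all
  define f where "f = restrict ((`) ?\<theta>) (verts \<Gamma>)"
  have f: "f (X #> k) = X #> k'" "f (Y #> k) = Y #> k'" "f (X #> (a \<otimes> k)) = X #> (b \<otimes> k')"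
    using img vertsI[OF k(1)] vertsI(1)[of "a \<otimes> k"] a k(1) by (simp_all add: f_def)
  have "f (X #> h) = X #> h" using f(1) k(3) k'(3) by metis
  moreover have "f v = v'" "f w = w'" using f(2,3) k(4,5) k'(4,5) by simp_all
  ultimately show ?thesis using coset_map_graph_aut[OF \<theta>] unfolding f_def by blast
qed

lemma locally_2_arc_transitive_coset_graph:
  assumes autX: "\<And>a b. a \<in> X - {\<one>} \<Longrightarrow> b \<in> X - {\<one>} \<Longrightarrow>
      \<exists>\<sigma>\<in>hom G G. bij_betw \<sigma> (carrier G) (carrier G) \<and> \<sigma> ` X = X \<and> \<sigma> ` Y = Y \<and> \<sigma> a = b"
    and autY: "\<And>a b. a \<in> Y - {\<one>} \<Longrightarrow> b \<in> Y - {\<one>} \<Longrightarrow>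
      \<exists>\<sigma>\<in>hom G G. bij_betw \<sigma> (carrier G) (carrier G) \<and> \<sigma> ` X = X \<and> \<sigma> ` Y = Y \<and> \<sigma> a = b"
  shows "locally_2_arc_transitive \<Gamma>"
  unfolding locally_2_arc_transitive_def
proof (intro ballI allI impI)
  fix u v w v' w'
  assume u: "u \<in> verts \<Gamma>" and arcs: "(u, v, w) \<in> two_arcs \<Gamma>" "(u, v', w') \<in> two_arcs \<Gamma>"
  show "\<exists>f\<in>graph_auts \<Gamma>. f u = u \<and> f v = v' \<and> f w = w'"
    using u
  proof (cases rule: verts_cases)
    case (X h)
    then show ?thesis using two_arc_transitive_at_X[OF autY X(1)] arcs by blast
  next
    case (Y h)
    have "\<exists>\<sigma>\<in>hom G G. bij_betw \<sigma> (carrier G) (carrier G) \<and> \<sigma> ` Y = Y \<and> \<sigma> ` X = X \<and> \<sigma> a = b"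
      if "a \<in> X - {\<one>}" "b \<in> X - {\<one>}" for a b
      using autX[OF that] by blast
    from coset_pair.two_arc_transitive_at_X[OF swapped this Y(1), unfolded coset_graph_swap] arcs Y(2)
    show ?thesis by blast
  qed
qed

end

subsection \<open>An invariant separating the two kinds of vertices\<close>

text \<open>A walk of length four without backtracking from \<open>u\<close> to \<open>v\<close>,
  with its second vertex \<open>a\<close> recorded.\<close>

definition path4 :: "'v ugraph \<Rightarrow> 'v \<Rightarrow> 'v \<Rightarrow> 'v \<Rightarrow> bool" where
  "path4 \<Gamma> u a v \<longleftrightarrow> (\<exists>b c. {u, a} \<in> edges \<Gamma> \<and> {a, b} \<in> edges \<Gamma> \<and> {b, c} \<in> edges \<Gamma> \<and> {c, v} \<in> edges \<Gamma> \<and>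
     u \<noteq> b \<and> a \<noteq> c \<and> b \<noteq> v)"

text \<open>Second vertices are counted rather than walks. For the group treated below,
  \<open>Y\<close> has this property when \<open>n \<ge> 2\<close>, while \<open>X\<close> has at
  most two second vertices for each end.\<close>

definition three_paths :: "'v ugraph \<Rightarrow> 'v \<Rightarrow> bool" where
  "three_paths \<Gamma> u \<longleftrightarrow> (\<exists>v a1 a2 a3. a1 \<noteq> a2 \<and> a1 \<noteq> a3 \<and> a2 \<noteq> a3 \<and>
     path4 \<Gamma> u a1 v \<and> path4 \<Gamma> u a2 v \<and> path4 \<Gamma> u a3 v)"

context coset_pair
begin

lemma X_coset_mult:
  assumes "x \<in> X" "k \<in> carrier G"
  shows "X #> (x \<otimes> k) = X #> k"
  using assms by (subst coset_eq_iff[OF subgroup_X]) auto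

lemma Y_coset_mult: "y \<in> Y \<Longrightarrow> k \<in> carrier G \<Longrightarrow> Y #> (y \<otimes> k) = Y #> k"
  by (rule coset_pair.X_coset_mult[OF swapped])

lemma Y_coset_mult_neq:
  assumes "x \<in> X" "x \<noteq> \<one>" "k \<in> carrier G"
  shows "Y #> (x \<otimes> k) \<noteq> Y #> k"
proof
  assume "Y #> (x \<otimes> k) = Y #> k"
  then obtain y where y: "y \<in> Y" "x \<otimes> k = y \<otimes> k"
    using coset_eq_iff[OF subgroup_Y, of "x \<otimes> k" k] assms by auto
  then have "x = y" using assms by simp
  then show False using y(1) assms X_Int_Y by blast
qed

lemma X_coset_mult_neq: "y \<in> Y \<Longrightarrow> y \<noteq> \<one> \<Longrightarrow> k \<in> carrier G \<Longrightarrow> X #> (y \<otimes> k) \<noteq> X #> k"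
  by (rule coset_pair.Y_coset_mult_neq[OF swapped])

lemma path4_aut:
  assumes f: "f \<in> graph_auts \<Gamma>" and "path4 \<Gamma> u a v"
  shows "path4 \<Gamma> (f u) (f a) (f v)"
proof -
  obtain b c where *: "{u, a} \<in> edges \<Gamma>" "{a, b} \<in> edges \<Gamma>" "{b, c} \<in> edges \<Gamma>" "{c, v} \<in> edges \<Gamma>"
     "u \<noteq> b" "a \<noteq> c" "b \<noteq> v"
    using assms(2) unfolding path4_def by blast
  then have "u \<in> verts \<Gamma>" "a \<in> verts \<Gamma>" "b \<in> verts \<Gamma>" "c \<in> verts \<Gamma>" "v \<in> verts \<Gamma>"
    using edges_verts by blast+
  then show ?thesis
    unfolding path4_def using * graph_autsD[OF f] by (intro exI[of _ "f b"] exI[of _ "f c"]) simp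
qed

lemma three_paths_aut:
  assumes f: "f \<in> graph_auts \<Gamma>" and "three_paths \<Gamma> u"
  shows "three_paths \<Gamma> (f u)"
proof -
  obtain v a1 a2 a3 where *: "a1 \<noteq> a2" "a1 \<noteq> a3" "a2 \<noteq> a3"
     "path4 \<Gamma> u a1 v" "path4 \<Gamma> u a2 v" "path4 \<Gamma> u a3 v"
    using assms(2) unfolding three_paths_def by blast
  have "a \<in> verts \<Gamma>" if "path4 \<Gamma> u a v" for a
    using that edges_verts[of u a] unfolding path4_def by blast
  then have "a1 \<in> verts \<Gamma>" "a2 \<in> verts \<Gamma>" "a3 \<in> verts \<Gamma>"
    using * by simp_all
  then have "f a1 \<noteq> f a2 \<and> f a1 \<noteq> f a3 \<and> f a2 \<noteq> f a3"
    using * graph_autsD(2)[OF f] by simp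
  then show ?thesis
    unfolding three_paths_def using path4_aut[OF f *(4)] path4_aut[OF f *(5)] path4_aut[OF f *(6)] by blast
qed

text \<open>Successive neighbours multiply the representative on the left by elements of
  \<open>X\<close> and \<open>Y\<close> in turn. Each condition against backtracking makes one of
  the last three factors nontrivial.\<close>

lemma path4_from_X:
  assumes "path4 \<Gamma> X a v"
  obtains x0 y1 x1 y2 where "x0 \<in> X" "y1 \<in> Y - {\<one>}" "x1 \<in> X - {\<one>}" "y2 \<in> Y - {\<one>}"
    "a = Y #> x0" "v = X #> (y2 \<otimes> (x1 \<otimes> (y1 \<otimes> x0)))"
proof -
  obtain b c where *: "{X, a} \<in> edges \<Gamma>" "{a, b} \<in> edges \<Gamma>" "{b, c} \<in> edges \<Gamma>" "{c, v} \<in> edges \<Gamma>"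
     "X \<noteq> b" "a \<noteq> c" "b \<noteq> v"
    using assms(1) unfolding path4_def by blast
  have X1: "X #> \<one> = X" using X.subset by simp
  obtain x0 where x0: "x0 \<in> X" "a = Y #> x0"
    using *(1) edge_at_X[of \<one> a] X1 by auto
  obtain y1 where y1: "y1 \<in> Y" "b = X #> (y1 \<otimes> x0)"
    using *(2) edge_at_Y[of x0 b] x0 by auto
  obtain x1 where x1: "x1 \<in> X" "c = Y #> (x1 \<otimes> (y1 \<otimes> x0))"
    using *(3) edge_at_X[of "y1 \<otimes> x0" c] x0 y1 by auto
  obtain y2 where y2: "y2 \<in> Y" "v = X #> (y2 \<otimes> (x1 \<otimes> (y1 \<otimes> x0)))"
    using *(4) edge_at_Y[of "x1 \<otimes> (y1 \<otimes> x0)" v] x0 y1 x1 by auto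
  have k: "x0 \<in> carrier G" "y1 \<otimes> x0 \<in> carrier G" "x1 \<otimes> (y1 \<otimes> x0) \<in> carrier G"
    using x0 y1 x1 by simp_all
  have "X #> x0 = X" using X_coset_mult[OF x0(1) one_closed] x0(1) X1 by simp
  then have "y1 \<noteq> \<one>" using *(5) unfolding y1(2) by (intro notI) (simp add: k)
  moreover have "x1 \<noteq> \<one>"
    using *(6) Y_coset_mult[OF y1(1) k(1)] unfolding x1(2) x0(2) by (intro notI) (simp add: k)
  moreover have "y2 \<noteq> \<one>"
    using *(7) X_coset_mult[OF x1(1) k(2)] unfolding y2(2) y1(2) by (intro notI) (simp add: k)
  ultimately show thesis using that x0 y1 x1 y2 by blast
qed

lemma path4_from_Y:
  assumes "y0 \<in> Y" "x \<in> X - {\<one>}" "y \<in> Y - {\<one>}" "x' \<in> X - {\<one>}"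
  shows "path4 \<Gamma> Y (X #> y0) (Y #> (x' \<otimes> (y \<otimes> (x \<otimes> y0))))"
proof -
  have mem: "x \<in> X" "y \<in> Y" "x' \<in> X" "x \<noteq> \<one>" "y \<noteq> \<one>" "x' \<noteq> \<one>" using assms by auto
  have k: "y0 \<in> carrier G" "x \<otimes> y0 \<in> carrier G" "y \<otimes> (x \<otimes> y0) \<in> carrier G"
    using assms(1) mem by simp_all
  have Y1: "Y #> \<one> = Y" using Y.subset by simp
  have Yy0: "Y #> y0 = Y" using Y_coset_mult[OF assms(1) one_closed] k Y1 by simp
  have "{Y, X #> y0} \<in> edges \<Gamma>"
    using edge_at_Y[OF k(1)] Y.one_closed k(1) l_one[OF k(1)] unfolding Yy0 by metis
  moreover have "{X #> y0, Y #> (x \<otimes> y0)} \<in> edges \<Gamma>"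
    using edge_at_X[OF k(1)] mem by blast
  moreover have "{Y #> (x \<otimes> y0), X #> (y \<otimes> (x \<otimes> y0))} \<in> edges \<Gamma>"
    using edge_at_Y[OF k(2)] mem by blast
  moreover have "{X #> (y \<otimes> (x \<otimes> y0)), Y #> (x' \<otimes> (y \<otimes> (x \<otimes> y0)))} \<in> edges \<Gamma>"
    using edge_at_X[OF k(3)] mem by blast
  moreover have "Y \<noteq> Y #> (x \<otimes> y0)"
    using Y_coset_mult_neq[OF mem(1,4) k(1)] unfolding Yy0 by metis
  moreover have "X #> y0 \<noteq> X #> (y \<otimes> (x \<otimes> y0))"
    using X_coset_mult_neq[OF mem(2,5) k(2)] unfolding X_coset_mult[OF mem(1) k(1)] by metis
  moreover have "Y #> (x \<otimes> y0) \<noteq> Y #> (x' \<otimes> (y \<otimes> (x \<otimes> y0)))"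
    using Y_coset_mult_neq[OF mem(3,6) k(3)] unfolding Y_coset_mult[OF mem(2) k(2)] by metis
  ultimately show ?thesis unfolding path4_def by blast
qed

end

subsection \<open>The graph of the group\<close>

context Hn_presented
begin

lemma y_neq_one: "j \<in> I \<Longrightarrow> y j \<noteq> \<one>"
  and x_neq_one: "i \<in> I \<Longrightarrow> x i \<noteq> \<one>"
  and y_inj: "i \<in> I \<Longrightarrow> j \<in> I \<Longrightarrow> i \<noteq> j \<Longrightarrow> y i \<noteq> y j"
proof -
  interpret Xb: C2_basis "G\<lparr>carrier := X\<rparr>" I x "\<lambda>i h. fst (\<phi> h) i" by (rule C2_basis_X)
  interpret Yb: C2_basis "G\<lparr>carrier := Y\<rparr>" I y "\<lambda>j h. snd (\<phi> h) (\<lambda>_. True, j)" by (rule C2_basis_Y)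
  show "x i \<noteq> \<one>" if i: "i \<in> I" for i
    using Xb.dual[OF i i] Xb.character_one[OF i] by auto
  show "y j \<noteq> \<one>" if j: "j \<in> I" for j
    using Yb.dual[OF j j] Yb.character_one[OF j] by auto
  show "y i \<noteq> y j" if ij: "i \<in> I" "j \<in> I" "i \<noteq> j" for i j
    using Yb.dual[OF ij(1) ij(1)] Yb.dual[OF ij(1) ij(2)] ij(3) by auto
qed

lemma coset_pair_XY:
  assumes "n \<ge> 1"
  shows "coset_pair G X Y"
proof (intro coset_pair.intro coset_pair_axioms.intro)
  have "x 1 \<in> X" "x 1 \<notin> Y"
    using x_in_X[of 1] x_neq_one[of 1] X_Int_Y assms by auto
  then show "X \<noteq> Y" by blast
qed (rule is_group subgroup_X subgroup_Y X_Int_Y)+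

text \<open>The product \<open>x 1 \<otimes> y 1 \<otimes> x 1\<close> is
  \<open>c 1 1 \<otimes> y 1\<close>, and \<open>c 1 1\<close> commutes with \<open>\<one>\<close>,
  \<open>y 1\<close> and \<open>y 2\<close>. So the walks through the \<open>X\<close>-cosets of
  these three elements all end at \<open>Y #> c 1 1\<close>; \<open>n \<ge> 2\<close> provides
  \<open>y 2\<close>.\<close>

lemma three_paths_Y:
  assumes "n \<ge> 2"
  shows "three_paths (coset_graph G X Y) Y"
proof -
  interpret coset_pair G X Y using coset_pair_XY assms by simp
  have I: "1 \<in> I" "2 \<in> I" using assms by auto
  have x1: "x 1 \<in> X - {\<one>}" and y1: "y 1 \<in> Y - {\<one>}" and y2: "y 2 \<in> Y - {\<one>}"
    using x_in_X y_in_Y x_neq_one y_neq_one I by blast+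
  define v where "v = Y #> c 1 1"
  have cl: "x 1 \<in> carrier G" "y 1 \<in> carrier G" "c 1 1 \<in> carrier G" using I by auto
  have *: "path4 \<Gamma> Y (X #> y0) v" if y0: "y0 \<in> Y" "c 1 1 \<otimes> y0 = y0 \<otimes> c 1 1" for y0
  proof -
    have y0c: "y0 \<in> carrier G" using y0 by (rule_tac Y_carrier)
    have "c 1 1 \<otimes> y 1 = x 1 \<otimes> (y 1 \<otimes> (x 1 \<otimes> (y 1 \<otimes> y 1)))"
      using cl I by (simp add: c_def group_comm_def inv_x inv_y m_assoc)
    then have xyx: "c 1 1 \<otimes> y 1 = x 1 \<otimes> (y 1 \<otimes> x 1)"
      using cl I yy by simp
    have "x 1 \<otimes> (y 1 \<otimes> (x 1 \<otimes> y0)) = (x 1 \<otimes> (y 1 \<otimes> x 1)) \<otimes> y0"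
      using cl y0c by (simp add: m_assoc)
    also have "\<dots> = y 1 \<otimes> c 1 1 \<otimes> y0"
      using xyx cy[OF I(1) I(1) I(1)] by simp
    also have "\<dots> = (y 1 \<otimes> y0) \<otimes> c 1 1"
      using cl y0c y0(2) by (simp add: m_assoc)
    finally have "Y #> (x 1 \<otimes> (y 1 \<otimes> (x 1 \<otimes> y0))) = v"
      unfolding v_def using Y_coset_mult[of "y 1 \<otimes> y0" "c 1 1"] y0(1) y1 cl by simp
    with path4_from_Y[OF y0(1) x1 y1 x1] show ?thesis by simp
  qed
  have "X #> y 1 \<noteq> X #> \<one>" "X #> y 2 \<noteq> X #> \<one>"
    using X_coset_mult_neq[of "y 1" \<one>] X_coset_mult_neq[of "y 2" \<one>] y1 y2 by auto
  moreover have "X #> y 1 \<noteq> X #> y 2"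
  proof -
    have "y 1 \<otimes> y 2 \<noteq> \<one>"
    proof
      assume "y 1 \<otimes> y 2 = \<one>"
      then have "inv (y 2) = y 1" using I by (intro inv_equality) auto
      then show False using inv_y[OF I(2)] y_inj[of 1 2] I by simp
    qed
    moreover have "y 1 \<otimes> y 2 \<otimes> y 2 = y 1" using I yy[OF I(2)] by (simp add: m_assoc)
    ultimately show ?thesis
      using X_coset_mult_neq[of "y 1 \<otimes> y 2" "y 2"] y1 y2 by auto
  qed
  moreover have "path4 \<Gamma> Y (X #> \<one>) v" using cl by (intro *) auto
  moreover have "path4 \<Gamma> Y (X #> y 1) v" "path4 \<Gamma> Y (X #> y 2) v"
    using y1 y2 cy[OF I(1) I(1)] I by (intro *; blast)+
  ultimately show ?thesis unfolding three_paths_def by metis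
qed

text \<open>Otherwise some quadratic polynomial is true at \<open>b\<close> and false at
  \<open>e\<close>, \<open>e'\<close> and \<open>b'\<close>. At a coordinate \<open>j\<close> with
  \<open>w1 j\<close> the assumed equality then fails.\<close>

lemma two_point_support:
  assumes "\<And>p j. quadratic p \<Longrightarrow> ((p e \<and> w2 j) \<noteq> (p b \<and> w1 j)) = ((p e' \<and> w2' j) \<noteq> (p b' \<and> w1' j))"
    and "e \<noteq> b" "w1 \<noteq> vzero"
  shows "b = e' \<or> b = b'"
proof (rule ccontr)
  assume "\<not> (b = e' \<or> b = b')"
  then obtain p where p: "quadratic p" "p b" "\<not> p e" "\<not> p e'" "\<not> p b'"
    using quadratic_separation[of b e e' b'] assms(2) by auto
  obtain j where "w1 j" using assms(3) by (auto simp: vzero_def)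
  with assms(1)[OF p(1), of j] p show False by simp
qed

text \<open>The two factors from \<open>Y\<close> map to evaluations at zero. The translations to
  their right move these to \<open>b\<close>, coming from \<open>x0\<close>, and to
  \<open>e\<close>, the sum of \<open>b\<close> and the nonzero translation of the middle
  \<open>X\<close>-factor.\<close>

lemma path4_X_data:
  assumes "n \<ge> 1" "path4 (coset_graph G X Y) X a v"
  obtains x0 b e w1 w2 h where "x0 \<in> X" "\<phi> x0 = mX b" "a = Y #> x0" "e \<noteq> b" "w1 \<noteq> vzero"
    "h \<in> carrier G" "v = X #> h"
    "\<And>p j. quadratic p \<Longrightarrow> snd (\<phi> h) (p, j) = ((p e \<and> w2 j) \<noteq> (p b \<and> w1 j))"
proof -
  interpret coset_pair G X Y using coset_pair_XY assms by simp
  obtain x0 y1 x1 y2 where *: "x0 \<in> X" "y1 \<in> Y - {\<one>}" "x1 \<in> X - {\<one>}" "y2 \<in> Y - {\<one>}"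
    "a = Y #> x0" "v = X #> (y2 \<otimes> (x1 \<otimes> (y1 \<otimes> x0)))"
    using path4_from_X[OF assms(2)] by blast
  obtain b where b: "\<phi> x0 = mX b" using \<phi>_X[OF *(1)] by blast
  obtain a1 where a1: "\<phi> x1 = mX a1" using \<phi>_X[of x1] *(3) by blast
  obtain w1 where w1: "\<phi> y1 = mY w1" using \<phi>_Y[of y1] *(2) by blast
  obtain w2 where w2: "\<phi> y2 = mY w2" using \<phi>_Y[of y2] *(4) by blast
  have cl: "x0 \<in> carrier G" "y1 \<in> carrier G" "x1 \<in> carrier G" "y2 \<in> carrier G"
    using * X_carrier Y_carrier by auto
  have one: "u = \<one>" if "u \<in> carrier G" "\<phi> u = \<one>\<^bsub>model\<^esub>" for u
    using that \<phi>_inj by (metis \<phi>.hom_one inj_onD one_closed)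
  have "a1 \<noteq> vzero" using one[OF cl(3)] a1 mX_zero *(3) by auto
  then have "a1 \<oplus>\<^sub>v b \<noteq> b" by (metis vadd_assoc vadd_simps(1,2))
  moreover have "w1 \<noteq> vzero" using one[OF cl(2)] w1 mY_zero *(2) by auto
  moreover have "snd (\<phi> (y2 \<otimes> (x1 \<otimes> (y1 \<otimes> x0)))) (p, j) = ((p (a1 \<oplus>\<^sub>v b) \<and> w2 j) \<noteq> (p b \<and> w1 j))"
    if "quadratic p" for p j
    using cl that by (simp add: b a1 w1 w2) (auto simp: mX_def mY_def vadd_apply shift_def vzero_apply)
  ultimately show thesis using that[OF *(1) b *(5)] cl *(6) by blast
qed

lemma snd_\<phi>_coset:
  assumes "n \<ge> 1" "h \<in> carrier G" "h' \<in> carrier G" "X #> h = X #> h'"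
  shows "snd (\<phi> h) = snd (\<phi> h')"
proof -
  obtain u where u: "u \<in> X" "h = u \<otimes> h'" using coset_eq_iff[OF subgroup_X assms(2,3)] assms(4) by blast
  then have "\<phi> h = mX (fst (\<phi> u)) \<otimes>\<^bsub>model\<^esub> \<phi> h'"
    using \<phi>_X[OF u(1)] X_carrier[OF u(1)] assms(3) by simp
  then show ?thesis by (cases "\<phi> h'") (simp add: mX_def)
qed

text \<open>All three walks yield the same second component. Comparing the second and third walk
  with the first puts \<open>b2\<close> and \<open>b3\<close> into \<open>{e1, b1}\<close>; both
  differ from \<open>b1\<close>, so both equal \<open>e1\<close>, although distinct second vertices
  require \<open>b2 \<noteq> b3\<close>.\<close>

lemma not_three_paths_X:
  assumes "n \<ge> 1"
  shows "\<not> three_paths (coset_graph G X Y) X"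
proof
  assume "three_paths (coset_graph G X Y) X"
  then obtain v a1 a2 a3 where a: "a1 \<noteq> a2" "a1 \<noteq> a3" "a2 \<noteq> a3"
    "path4 (coset_graph G X Y) X a1 v" "path4 (coset_graph G X Y) X a2 v" "path4 (coset_graph G X Y) X a3 v"
    unfolding three_paths_def by blast
  obtain x1 b1 e1 u1 w1 h1 where 1: "x1 \<in> X" "\<phi> x1 = mX b1" "a1 = Y #> x1" "e1 \<noteq> b1" "u1 \<noteq> vzero"
    "h1 \<in> carrier G" "v = X #> h1"
    "\<And>p j. quadratic p \<Longrightarrow> snd (\<phi> h1) (p, j) = ((p e1 \<and> w1 j) \<noteq> (p b1 \<and> u1 j))"
    by (rule path4_X_data[OF assms a(4)]) (rule that)
  obtain x2 b2 e2 u2 w2 h2 where 2: "x2 \<in> X" "\<phi> x2 = mX b2" "a2 = Y #> x2" "e2 \<noteq> b2" "u2 \<noteq> vzero"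
    "h2 \<in> carrier G" "v = X #> h2"
    "\<And>p j. quadratic p \<Longrightarrow> snd (\<phi> h2) (p, j) = ((p e2 \<and> w2 j) \<noteq> (p b2 \<and> u2 j))"
    by (rule path4_X_data[OF assms a(5)]) (rule that)
  obtain x3 b3 e3 u3 w3 h3 where 3: "x3 \<in> X" "\<phi> x3 = mX b3" "a3 = Y #> x3" "e3 \<noteq> b3" "u3 \<noteq> vzero"
    "h3 \<in> carrier G" "v = X #> h3"
    "\<And>p j. quadratic p \<Longrightarrow> snd (\<phi> h3) (p, j) = ((p e3 \<and> w3 j) \<noteq> (p b3 \<and> u3 j))"
    by (rule path4_X_data[OF assms a(6)]) (rule that)
  have x_eq: "r = s" if "r \<in> X" "s \<in> X" "\<phi> r = \<phi> s" for r s
    using that \<phi>_inj X_carrier by (meson inj_onD)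
  have "b1 \<noteq> b2" "b1 \<noteq> b3" "b2 \<noteq> b3"
    using x_eq[OF 1(1) 2(1)] x_eq[OF 1(1) 3(1)] x_eq[OF 2(1) 3(1)] 1(2,3) 2(2,3) 3(2,3) a(1-3) by auto
  moreover have "snd (\<phi> h2) = snd (\<phi> h1)" "snd (\<phi> h3) = snd (\<phi> h1)"
    using snd_\<phi>_coset[OF assms 2(6) 1(6)] snd_\<phi>_coset[OF assms 3(6) 1(6)] 1(7) 2(7) 3(7) by auto
  then have "b2 = e1 \<or> b2 = b1" "b3 = e1 \<or> b3 = b1"
    using two_point_support[of e2 w2 b2 u2 e1 w1 b1 u1] two_point_support[of e3 w3 b3 u3 e1 w1 b1 u1]
      1(8) 2(8) 3(8) 2(4,5) 3(4,5) by simp_all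
  ultimately show False by blast
qed

lemma not_vertex_transitive:
  assumes "n \<ge> 2"
  shows "\<not> vertex_transitive (coset_graph G X Y)"
proof
  interpret coset_pair G X Y using coset_pair_XY assms by simp
  assume *: "vertex_transitive \<Gamma>"
  have "X \<in> verts \<Gamma>" "Y \<in> verts \<Gamma>"
    using vertsI[OF one_closed] X.subset Y.subset by simp_all
  then obtain f where "f \<in> graph_auts \<Gamma>" "f Y = X" using * unfolding vertex_transitive_def by blast
  then show False
    using three_paths_aut[of f Y] three_paths_Y[OF assms] not_three_paths_X assms by simp
qed

text \<open>Both exponents are rewritten through \<open>n choose 2\<close>, using that
  \<open>n * n\<close> is twice this number plus \<open>n\<close>; this shows that the divisions by
  two are exact.\<close>

lemma order_exponent: "order G = 2 ^ (n * (n\<^sup>2 + n + 4) div 2)"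
  and verts_exponent: "n \<ge> 1 \<Longrightarrow> card (verts (coset_graph G X Y)) = 2 ^ (n\<^sup>2 * (n + 1) div 2 + n + 1)"
proof -
  let ?c = "n choose 2"
  have c: "n * n = 2 * ?c + n"
    by (cases n) (simp_all add: choose_two)
  have c3: "n * n * n = 2 * (?c * n) + n * n"
    using arg_cong[OF c, of "\<lambda>z. z * n"] by (simp add: algebra_simps)
  have "n * (n\<^sup>2 + n + 4) = 2 * (n + (1 + n + ?c) * n)"
    using c3 by (simp add: power2_eq_square algebra_simps)
  then have e: "n * (n\<^sup>2 + n + 4) div 2 = n + (1 + n + ?c) * n"
    by simp
  have ord: "order G = 2 ^ (n + (1 + n + ?c) * n)"
    by (simp only: order_G power_add)
  show "order G = 2 ^ (n * (n\<^sup>2 + n + 4) div 2)" unfolding e by (rule ord)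
  assume n: "n \<ge> 1"
  have "n\<^sup>2 * (n + 1) = 2 * (n * n + ?c * n)"
    using c3 by (simp add: power2_eq_square algebra_simps)
  then have "n\<^sup>2 * (n + 1) div 2 + n + 1 + n = 1 + (n + (1 + n + ?c) * n)"
    by (simp add: algebra_simps)
  then have "2 ^ (n\<^sup>2 * (n + 1) div 2 + n + 1) * 2 ^ n = 2 * order G"
    unfolding ord by (metis power_Suc power_add plus_1_eq_Suc)
  also have "\<dots> = card (verts (coset_graph G X Y)) * 2 ^ n"
    using coset_pair.card_verts[OF coset_pair_XY[OF n] finite_G, of "2 ^ n"]
      C2_basis.card_carrier[OF C2_basis_X] C2_basis.card_carrier[OF C2_basis_Y] by simp
  finally show "card (verts (coset_graph G X Y)) = 2 ^ (n\<^sup>2 * (n + 1) div 2 + n + 1)" by simp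
qed

lemma coset_graph_properties:
  assumes "n \<ge> 2"
  shows "semisymmetric (coset_graph G X Y)" "locally_2_arc_transitive (coset_graph G X Y)"
    "has_valency (coset_graph G X Y) (2 ^ n)"
proof -
  interpret coset_pair G X Y using coset_pair_XY assms by simp
  show val: "has_valency \<Gamma> (2 ^ n)"
    using C2_basis.card_carrier[OF C2_basis_X] C2_basis.card_carrier[OF C2_basis_Y]
    by (intro has_valency_card) simp_all
  show "semisymmetric \<Gamma>"
    unfolding semisymmetric_def
    using simple val edge_transitive_coset_graph not_vertex_transitive[OF assms] by blast
  show "locally_2_arc_transitive \<Gamma>"
    using automorphism_X automorphism_Y by (intro locally_2_arc_transitive_coset_graph) auto
qed

end

section \<open>The presented group as an instance of \<open>Hn_presented\<close>\<close>

lemma presentation_Hn: "presentation (gens n) (Hn_relators n)"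
  by unfold_locales (rule Hn_relators_words)

lemma word_class_eq_cls: "word_class n w = presentation.cls (gens n) (Hn_relators n) w"
  by (simp add: word_class_def presentation.cls_def[OF presentation_Hn])

lemma Hn_von_Dyck:
  assumes K: "group K" and xy: "x ` {1..n} \<subseteq> carrier K" "y ` {1..n} \<subseteq> carrier K"
    and rel: "Hn_relations K (x ` {1..n}) (y ` {1..n})"
  shows "\<exists>h\<in>hom (Hn n) K. \<forall>i\<in>{1..n}.
    h (word_class n [(Xgen i, True)]) = x i \<and> h (word_class n [(Ygen i, True)]) = y i"
proof -
  interpret pr: presentation "gens n" "Hn_relators n" by (rule presentation_Hn)
  define f where "f k = (case k of Xgen i \<Rightarrow> x i | Ygen i \<Rightarrow> y i)" for k
  have f: "f ` gens n \<subseteq> carrier K" using xy by (auto simp: f_def gens_def)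
  have "word_eval K f r = \<one>\<^bsub>K\<^esub>" if "r \<in> Hn_relators n" for r
    using group.word_eval_Hn_relators[OF K f] that rel by (simp add: f_def)
  then obtain h where h: "h \<in> hom pr.P K" "\<And>k. k \<in> gens n \<Longrightarrow> h (pr.cls [(k, True)]) = f k"
    using pr.von_Dyck[OF K f] by metis
  have "Xgen i \<in> gens n" "Ygen i \<in> gens n" if "i \<in> {1..n}" for i
    using that by (auto simp: gens_def)
  with h show ?thesis
    unfolding Hn_def word_class_eq_cls by (intro bexI[of _ h]) (auto simp: f_def)
qed

theorem theorem1p3:
  fixes n :: nat
  assumes "n \<ge> 2"
  shows "mixed_dihedral n (Hn n) (Xn n) (Yn n) \<and>
    order (Hn n) = 2 ^ ((n * (n\<^sup>2 + n + 4)) div 2) \<and>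
    semisymmetric (coset_graph (Hn n) (Xn n) (Yn n)) \<and>
    locally_2_arc_transitive (coset_graph (Hn n) (Xn n) (Yn n)) \<and>
    has_valency (coset_graph (Hn n) (Xn n) (Yn n)) (2 ^ n) \<and>
    card (verts (coset_graph (Hn n) (Xn n) (Yn n))) = 2 ^ ((n\<^sup>2 * (n + 1)) div 2 + n + 1)"
proof -
  interpret pr: presentation "gens n" "Hn_relators n"
    by (rule presentation_Hn)
  have H: "Hn n = pr.P" by (simp add: Hn_def)
  define g where "g k = word_class n [(k, True)]" for k
  have g_cls: "g = (\<lambda>k. pr.cls [(k, True)])" by (rule ext) (simp add: g_def word_class_eq_cls)
  let ?x = "\<lambda>i. g (Xgen i)" and ?y = "\<lambda>i. g (Ygen i)"
  have g: "g ` gens n \<subseteq> carrier pr.P" by (auto simp: g_cls)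
  have gens: "Xgen i \<in> gens n" "Ygen i \<in> gens n" if "i \<in> {1..n}" for i
    using that by (auto simp: gens_def)
  have rel: "Hn_relations pr.P (?x ` {1..n}) (?y ` {1..n})"
    using pr.P.word_eval_Hn_relators[OF g] pr.word_eval_relator by (simp add: g_cls)
  \<comment> \<open>Unit vectors are the images chosen for the generators; von Dyck's theorem then
    gives the homomorphism into the model.\<close>
  have "Hn_relations model ((\<lambda>i. mX (unit_vec i)) ` {1..n}) ((\<lambda>i. mY (unit_vec i)) ` {1..n})"
    by (rule Hn_relations_mono[OF Hn_relations_model]) auto
  then obtain \<phi> where \<phi>: "\<phi> \<in> hom pr.P model"
    "\<And>i. i \<in> {1..n} \<Longrightarrow> \<phi> (?x i) = mX (unit_vec i)" "\<And>i. i \<in> {1..n} \<Longrightarrow> \<phi> (?y i) = mY (unit_vec i)"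
    using Hn_von_Dyck[OF group_model, of "\<lambda>i. mX (unit_vec i)" n "\<lambda>i. mY (unit_vec i)"]
    unfolding g_def H by auto
  have XY: "?x ` {1..n} \<union> ?y ` {1..n} = g ` gens n" by (auto simp: gens_def)
  have generated: "carrier pr.P = generate pr.P (?x ` {1..n} \<union> ?y ` {1..n})"
  proof
    show "carrier pr.P \<subseteq> generate pr.P (?x ` {1..n} \<union> ?y ` {1..n})"
    proof
      fix z assume "z \<in> carrier pr.P"
      then show "z \<in> generate pr.P (?x ` {1..n} \<union> ?y ` {1..n})"
        unfolding XY
      proof (induction rule: pr.generated_induct)
        case one
        show ?case by (rule generate.one)
      next
        case (gen k y)
        then show ?case unfolding g_cls by (blast intro: generate.eng generate.incl)
      next
        case (inv k y)
        then show ?case unfolding g_cls by (blast intro: generate.eng generate.inv)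
      qed
    qed
  qed (use pr.P.generate_incl g XY in simp)
  interpret Hn_presented pr.P n ?x ?y \<phi>
  proof unfold_locales
    \<comment> \<open>The assumption \<open>lift\<close> is von Dyck's theorem with the presented
      group itself as target.\<close>
    show "\<exists>h\<in>hom pr.P pr.P. \<forall>i\<in>{1..n}. h (?x i) = x' i \<and> h (?y i) = y' i"
      if "x' ` {1..n} \<subseteq> carrier pr.P" "y' ` {1..n} \<subseteq> carrier pr.P"
        "Hn_relations pr.P (x' ` {1..n}) (y' ` {1..n})" for x' y'
      using Hn_von_Dyck[OF pr.group_P that] unfolding g_def H .
    show "?x i \<in> carrier pr.P" "?y i \<in> carrier pr.P" if "i \<in> {1..n}" for i
      using g gens[OF that] by auto
  qed (use generated rel \<phi> in blast)+
  have "word_class n ` X0_words n = ?x ` {1..n}" "word_class n ` Y0_words n = ?y ` {1..n}"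
    by (auto simp: g_def X0_words_def Y0_words_def)
  then have "Xn n = X" "Yn n = Y" by (simp_all add: Xn_def Yn_def X_def Y_def H)
  then show ?thesis
    using mixed_dihedral_XY order_exponent coset_graph_properties[OF assms] verts_exponent assms
    unfolding H by simp
qed

end
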